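(* Let $n$ be a positive integer divisible by two distinct odd primes $p$ and $q$, and let $\alpha\ge 1$ be such that $p^{\alpha}\parallel n$ (i.e. $p^\alpha\mid n$ and $p^{\alpha+1}\nmid n$). Then $p^{\alpha+1}\notin S_n$.
   Context: For a positive integer $n$, $S_n$ denotes the set of all $n\times n$ circulant determinants with integer entries, i.e. $S_n=\{\det(a_{(j-i)\bmod n})_{0\le i,j\le n-1} : (a_0,\dots,a_{n-1})\in\mathbb Z^n\}$. Equivalently $S_n=\{M_n(F): F\in\mathbb Z[x]\}$, where $M_n(F)=\prod_{j=1}^n F(\omega_n^j)$ and $\omega_n=e^{2\pi i/n}$. *)

theory Defs
  imports
    "Jordan_Normal_Form.Determinant"
    "HOL-Computational_Algebra.Primes"
begin

text \<open>
  The index \<open>(j + dim_vec a - i) mod dim_vec a\<close> is \<open>(j - i) mod n\<close> for \<open>n = dim_vec a\<close>; since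
  \<open>i < n\<close>, the subtraction on \<open>nat\<close> does not truncate.
\<close>

definition circulant_mat :: "'a vec \<Rightarrow> 'a mat" where
  "circulant_mat a =
     mat (dim_vec a) (dim_vec a) (\<lambda>(i, j). a $ ((j + dim_vec a - i) mod dim_vec a))"

definition circulant_dets :: "nat \<Rightarrow> int set" where
  "circulant_dets n = {det (circulant_mat a) |a. a \<in> carrier_vec n}"

end

theory Submission
  imports Defs "Jordan_Normal_Form.Char_Poly" "HOL-Number_Theory.Totient"
begin

text \<open>
  For \<open>F \<in> \<int>[x]\<close> the circulant determinant is the product of \<open>F\<close> over the \<open>n\<close>-th roots of unity.
  Multiplying \<open>F\<close> over the fibres of \<open>z \<mapsto> z\<^sup>k\<close> gives another integer polynomial, so one may assume
  \<open>n = p\<^sup>\<alpha>q\<close>. The determinant is then the product over \<open>d | n\<close> of the integers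
  \<open>N\<^sub>d = \<Prod>F(z)\<close>, \<open>z\<close> running over the primitive \<open>d\<close>-th roots of unity. Modulo the primes above \<open>p\<close>
  every root of unity of \<open>p\<close>-power order is \<open>1\<close>, hence \<open>p | N\<^sub>m\<close> iff \<open>p | N\<^bsub>mp^i\<^esub>\<close>. So if the
  determinant is \<open>p\<^bsup>\<alpha>+1\<^esup>\<close>, then for one \<open>m \<in> {1, q}\<close> all \<open>N\<^bsub>mp^i\<^esub>\<close> with \<open>i \<le> \<alpha>\<close> are \<open>\<plusminus>p\<close>,
  and all other \<open>N\<^sub>d\<close> are \<open>\<plusminus>1\<close>.

  If \<open>N\<^sub>d = \<plusminus>1\<close> with \<open>d\<close> odd, then by Kronecker's theorem \<open>F(z) = \<epsilon> z\<^sup>c F(1/z)\<close> with a sign \<open>\<epsilon>\<close>.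
  For \<open>d = p\<close> reduction modulo \<open>1 - z\<close> gives \<open>\<epsilon> = 1\<close>; if instead \<open>N\<^sub>p = \<plusminus>p\<close>, then \<open>F(z)\<close> is a unit
  times \<open>1 - z = -z (1 - 1/z)\<close> and the sign is \<open>-1\<close>. Comparing the signs for \<open>d = p, q, pq\<close> modulo
  the primes above \<open>p\<close> and \<open>q\<close> is contradictory in both cases.
\<close>

section \<open>Circulant determinants and norm polynomials\<close>

abbreviation ev :: "int poly \<Rightarrow> complex \<Rightarrow> complex" where
  "ev F z \<equiv> poly (of_int_poly F) z"

text \<open>The Vandermonde matrix \<open>V\<close> of the \<open>w i\<close> has eigenvectors as
  columns, so \<open>A * V = V * D\<close>, and distinct nodes let \<open>det V\<close> be
  cancelled. It serves circulant and multiplication matrices alike.\<close>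

lemma det_eq_prod_eigenvalues:
  fixes A :: "'a::field mat"
  assumes A: "A \<in> carrier_mat k k"
    and inj: "inj_on w {..<k}"
    and eig: "\<And>r i. r < k \<Longrightarrow> i < k \<Longrightarrow> (\<Sum>s<k. A $$ (r, s) * w i ^ s) = l i * w i ^ r"
  shows "det A = (\<Prod>i<k. l i)"
proof -
  define V where "V = mat k k (\<lambda>(s, i). w i ^ s)"
  define D where "D = mat k k (\<lambda>(i, j). if i = j then l i else 0)"
  have V: "V \<in> carrier_mat k k" and D: "D \<in> carrier_mat k k"
    by (auto simp: V_def D_def)
  have "A * V = V * D"
  proof (rule eq_matI)
    fix r i assume "r < dim_row (V * D)" "i < dim_col (V * D)"
    then have ri: "r < k" "i < k" using V D by auto
    have "(A * V) $$ (r, i) = (\<Sum>s<k. A $$ (r, s) * w i ^ s)"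
      using ri A V by (auto simp: scalar_prod_def V_def lessThan_atLeast0 intro!: sum.cong)
    moreover have "(V * D) $$ (r, i) = (\<Sum>s<k. w s ^ r * (if s = i then l s else 0))"
      using ri V D by (auto simp: scalar_prod_def V_def D_def lessThan_atLeast0 intro!: sum.cong)
    moreover have "\<dots> = l i * w i ^ r"
      using ri by (simp add: if_distrib[of "\<lambda>x. _ * x"] cong: if_cong)
    ultimately show "(A * V) $$ (r, i) = (V * D) $$ (r, i)"
      using eig[OF ri] by simp
  qed (use A V D in auto)
  then have "det A * det V = det V * det D"
    using det_mult[OF A V] det_mult[OF V D] by metis
  moreover have "det V \<noteq> 0"
  proof
    assume "det V = 0"
    then have "det (transpose_mat V) = 0" using det_transpose[OF V] by simp
    then obtain v where v: "v \<in> carrier_vec k" "v \<noteq> 0\<^sub>v k" "transpose_mat V *\<^sub>v v = 0\<^sub>v k"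
      using det_0_iff_vec_prod_zero[of "transpose_mat V" k] V by auto
    \<comment> \<open>A null vector lists the coefficients of a polynomial of degree below
      \<open>k\<close> with the \<open>k\<close> distinct roots \<open>w i\<close>, so it
      vanishes.\<close>
    define P where "P = (\<Sum>s<k. monom (v $ s) s)"
    have cP: "coeff P s = (if s < k then v $ s else 0)" for s
      by (simp add: P_def coeff_sum)
    have "poly P (w i) = 0" if "i < k" for i
    proof -
      have "(transpose_mat V *\<^sub>v v) $ i = (\<Sum>s<k. w i ^ s * v $ s)"
        using that V v(1) by (auto simp: scalar_prod_def V_def lessThan_atLeast0 intro!: sum.cong)
      then show ?thesis using v(3) that
        by (simp add: P_def poly_sum poly_monom mult.commute)
    qed
    then have sub: "w ` {..<k} \<subseteq> {x. poly P x = 0}" by auto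
    have "P = 0"
    proof (rule ccontr)
      assume "P \<noteq> 0"
      then have "k \<le> degree P"
        using card_mono[OF poly_roots_finite sub] card_poly_roots_bound[of P] card_image[OF inj]
            by auto
      moreover have "degree P < k"
      proof (cases "k = 0")
        case False
        have "degree P \<le> k - 1" by (rule degree_le) (use False in \<open>auto simp: cP\<close>)
        then show ?thesis using False by simp
      qed (use \<open>P \<noteq> 0\<close> P_def in auto)
      ultimately show False by simp
    qed
    then have "v $ s = 0" if "s < k" for s using cP[of s] that by simp
    then show False using v(1,2) by (metis carrier_vecD eq_vecI index_zero_vec(1) index_zero_vec(2))
  qed
  moreover have "det D = (\<Prod>i<k. l i)"
    using det_upper_triangular[OF _ D]
    by (auto simp: D_def upper_triangular_def prod_list_diag_prod lessThan_atLeast0)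
  ultimately show ?thesis by simp
qed

text \<open>The matrix of multiplication
    by \<open>F\<close> on \<open>\<int>[x]\<close>, a free module over \<open>\<int>[x\<^sup>k]\<close> with basis \<open>1, \<dots>, x\<^bsup>k-1\<^esup>\<close>;
  the entries are polynomials in \<open>x\<^sup>k\<close>.\<close>

definition mult_mat :: "nat \<Rightarrow> int poly \<Rightarrow> int poly mat" where
  "mult_mat k F = mat k k (\<lambda>(r, s). \<Sum>t\<le>degree F.
     if (r + t) mod k = s then monom (coeff F t) ((r + t) div k) else 0)"

lemma mult_mat_carrier [simp]: "mult_mat k F \<in> carrier_mat k k"
  by (simp add: mult_mat_def)

lemma ev_altdef: "ev F z = (\<Sum>t\<le>degree F. of_int (coeff F t) * z ^ t)"
  by (simp add: poly_altdef)

text \<open>Row \<open>r\<close> expands \<open>x^r * F\<close> in the basis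
  \<open>1, ..., x^(k-1)\<close>; evaluated at \<open>w\<close>, this makes the vector of powers of
  \<open>w\<close> an eigenvector.\<close>

lemma mult_mat_eigen:
  assumes r: "r < k"
  shows "(\<Sum>s<k. ev (mult_mat k F $$ (r, s)) (w ^ k) * w ^ s) = ev F w * w ^ r"
proof -
  have "(\<Sum>s<k. ev (mult_mat k F $$ (r, s)) (w ^ k) * w ^ s)
      = (\<Sum>s<k. \<Sum>t\<le>degree F. if (r + t) mod k
          = s then of_int (coeff F t) * (w ^ k) ^ ((r + t) div k) * w ^ s else 0)"
    using r by (auto simp: mult_mat_def of_int_poly_hom.hom_sum poly_sum sum_distrib_right
        poly_monom map_poly_monom
        if_distrib[of of_int_poly] intro!: sum.cong)
  also have "\<dots> = (\<Sum>t\<le>degree F. of_int (coeff F t) * (w ^ k) ^ ((r + t) div k) * w ^ ((r + t) mod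
      k))"
    by (subst sum.swap, rule sum.cong) (use r in auto)
  also have "\<dots> = (\<Sum>t\<le>degree F. of_int (coeff F t) * w ^ (r + t))"
    by (intro sum.cong refl) (simp add: mult.assoc flip: power_mult power_add)
  also have "\<dots> = ev F w * w ^ r"
    unfolding ev_altdef sum_distrib_right by (intro sum.cong refl) (simp add: power_add)
  finally show ?thesis .
qed

lemma ev_hom: "comm_ring_hom (\<lambda>F. ev F z)"
  by unfold_locales (auto simp: hom_distribs)

lemma card_power_eq:
  assumes "k > 0" "w \<noteq> (0::complex)"
  shows "finite {v. v ^ k = w}" "card {v. v ^ k = w} = k"
  using assms by (auto simp: card_nth_roots finite_nth_roots)

text \<open>\<open>H\<close> is the norm of \<open>F\<close> from \<open>Z[x]\<close> down to
  \<open>Z[x^k]\<close>, written in the variable \<open>x^k\<close>: the evaluated multiplication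
  matrix has the eigenvalues \<open>F(v)\<close>. For nonzero \<open>w\<close> there are
  \<open>k\<close> distinct \<open>v\<close>.\<close>

lemma norm_poly_exists:
  assumes k: "k > 0"
  obtains H where "\<And>w. w \<noteq> 0 \<Longrightarrow> ev H w = (\<Prod>v\<in>{v. v ^ k = w}. ev F v)"
proof
  fix w :: complex assume w: "w \<noteq> 0"
  obtain h where h: "bij_betw h {..<k} {v. v ^ k = w}"
    using card_power_eq[OF k w] by (metis ex_bij_betw_nat_finite lessThan_atLeast0)
  interpret comm_ring_hom "\<lambda>F. ev F w" by (rule ev_hom)
  have "ev (det (mult_mat k F)) w = det (map_mat (\<lambda>F. ev F w) (mult_mat k F))"
    by (simp add: hom_det)
  also have "\<dots> = (\<Prod>i<k. ev F (h i))"
  proof (rule det_eq_prod_eigenvalues)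
    show "inj_on h {..<k}" using h by (auto simp: bij_betw_def)
    fix r i assume ri: "r < k" "i < k"
    then have "h i ^ k = w" using h by (auto simp: bij_betw_def)
    then show "(\<Sum>s<k. map_mat (\<lambda>F. ev F w) (mult_mat k F) $$ (r, s) * h i ^ s)
        = ev F (h i) * h i ^ r"
      using mult_mat_eigen[OF ri(1), of F "h i"] ri by (auto simp: mult_mat_def)
  qed simp
  also have "\<dots> = (\<Prod>v\<in>{v. v ^ k = w}. ev F v)"
    by (rule prod.reindex_bij_betw[OF h])
  finally show "ev (det (mult_mat k F)) w = (\<Prod>v\<in>{v. v ^ k = w}. ev F v)" .
qed

text \<open>Putting 1 for \<open>x^d\<close> in the multiplication matrix gives an integer matrix
  with eigenvalue \<open>F(z)\<close>, which is therefore a root of a monic integer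
  polynomial.\<close>

lemma algebraic_int_ev_root_unity:
  assumes d: "d > 0" and z: "z ^ d = 1"
  shows "algebraic_int (ev F z)"
proof -
  define M where "M = map_mat (\<lambda>g. poly g 1) (mult_mat d F)"
  have M: "M \<in> carrier_mat d d" by (simp add: M_def)
  define C where "C = map_mat complex_of_int M"
  have C: "C \<in> carrier_mat d d" using M by (simp add: C_def)
  define v where "v = vec d (\<lambda>s. z ^ s)"
  have "C *\<^sub>v v = ev F z \<cdot>\<^sub>v v"
  proof (rule eq_vecI)
    fix r assume "r < dim_vec (ev F z \<cdot>\<^sub>v v)"
    then have r: "r < d" by (simp add: v_def)
    have *: "complex_of_int (poly g 1) = ev g 1" for g
      by (metis of_int_hom.poly_map_poly of_int_1)
    have "(C *\<^sub>v v) $ r = (\<Sum>s<d. C $$ (r, s) * z ^ s)"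
      using r C by (auto simp: scalar_prod_def v_def lessThan_atLeast0 intro!: sum.cong)
    also have "\<dots> = (\<Sum>s<d. ev (mult_mat d F $$ (r, s)) (z ^ d) * z ^ s)"
    proof (intro sum.cong refl)
      fix s assume "s \<in> {..<d}"
      then have "C $$ (r, s) = complex_of_int (poly (mult_mat d F $$ (r, s)) 1)"
        using r by (simp add: C_def M_def mult_mat_def)
      then show "C $$ (r, s) * z ^ s = ev (mult_mat d F $$ (r, s)) (z ^ d) * z ^ s"
        by (simp only: * z)
    qed
    finally show "(C *\<^sub>v v) $ r = (ev F z \<cdot>\<^sub>v v) $ r"
      using mult_mat_eigen[OF r, of F z] r by (simp add: v_def)
  qed (use C in \<open>simp add: v_def\<close>)
  moreover have "v $ 0 \<noteq> 0\<^sub>v d $ 0" using d by (simp add: v_def)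
  then have "v \<noteq> 0\<^sub>v d" by auto
  ultimately have "eigenvalue C (ev F z)"
    using C by (auto simp: eigenvalue_def eigenvector_def v_def intro!: exI[of _ v])
  then have "poly (char_poly C) (ev F z) = 0"
    using eigenvalue_root_char_poly[OF C] by simp
  then have "ev (char_poly M) (ev F z) = 0"
    by (simp add: C_def of_int_hom.char_poly_hom[OF M])
  then show ?thesis
    using degree_monic_char_poly[OF M] by (auto simp: algebraic_int_altdef_ipoly)
qed

text \<open>\<open>F\<close> has coefficient vector \<open>a\<close>; for every \<open>n\<close>-th
  root of unity \<open>w\<close> the vector of powers of \<open>w\<close> is an eigenvector with
  eigenvalue \<open>F(w)\<close>.\<close>

lemma det_circulant_mat:
  assumes a: "a \<in> carrier_vec n" and n: "n > 0"
  obtains F where "of_int (det (circulant_mat a)) = (\<Prod>v\<in>{v. v ^ n = 1}. ev F v)"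
proof
  define F where "F = (\<Sum>t<n. monom (a $ t) t)"
  have da: "dim_vec a = n" using a by auto
  have F: "ev F w = (\<Sum>t<n. of_int (a $ t) * w ^ t)" for w
    by (simp add: F_def hom_distribs poly_sum poly_monom map_poly_monom)
  obtain h where h: "bij_betw h {..<n} {v::complex. v ^ n = 1}"
    using card_power_eq[OF n, of 1] by (metis ex_bij_betw_nat_finite lessThan_atLeast0 zero_neq_one)
  have "of_int (det (circulant_mat a)) = det (map_mat complex_of_int (circulant_mat a))"
    by (simp add: of_int_hom.hom_det)
  also have "\<dots> = (\<Prod>i<n. ev F (h i))"
  proof (rule det_eq_prod_eigenvalues)
    show "inj_on h {..<n}" using h by (auto simp: bij_betw_def)
    fix r i assume ri: "r < n" "i < n"
    define w where "w = h i"
    have w: "w ^ n = 1" using h ri by (auto simp: bij_betw_def w_def)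
    \<comment> \<open>The index shift by \<open>r\<close> modulo \<open>n\<close> is undone by
      subtracting \<open>r\<close>; the added \<open>n\<close> keeps the natural subtraction from
      truncating.\<close>
    have inv: "((t + r) mod n + n - r) mod n = t" if "t < n" for t
    proof (cases "t + r < n")
      case False
      then have "(t + r) mod n = t + r - n" using that ri by (simp add: le_mod_geq)
      then show ?thesis using False that by simp
    qed simp
    have inv': "((s + n - r) mod n + r) mod n = s" if "s < n" for s
    proof (cases "s < r")
      case True
      then show ?thesis using that ri by simp
    next
      case False
      then have "s + n - r = (s - r) + n" by simp
      then have "(s + n - r) mod n = s - r" using that by (simp only: mod_add_self2) simp
      then show ?thesis using False that by simp
    qed
    have bij: "bij_betw (\<lambda>t. (t + r) mod n) {..<n} {..<n}"
      by (rule bij_betwI[where g = "\<lambda>s. (s + n - r) mod n"]) (use n inv inv' in auto)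
    have wp: "w ^ ((t + r) mod n) = w ^ (t + r)" for t
    proof -
      have "w ^ (t + r) = w ^ (n * ((t + r) div n) + (t + r) mod n)" by simp
      then show ?thesis by (simp only: power_add power_mult w) simp
    qed
    have "(\<Sum>s<n. map_mat complex_of_int (circulant_mat a) $$ (r, s) * w ^ s)
        = (\<Sum>s<n. of_int (a $ ((s + n - r) mod n)) * w ^ s)"
      using ri by (auto simp: circulant_mat_def da intro!: sum.cong)
    also have "\<dots> = (\<Sum>t<n. of_int (a $ (((t + r) mod n + n - r) mod n)) * w ^ ((t + r) mod n))"
      by (rule sum.reindex_bij_betw[OF bij, symmetric])
    also have "\<dots> = (\<Sum>t<n. of_int (a $ t) * w ^ (t + r))"
      by (intro sum.cong refl) (simp add: inv wp)
    also have "\<dots> = ev F w * w ^ r"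
      unfolding F sum_distrib_right by (intro sum.cong refl) (simp add: power_add)
    finally show "(\<Sum>s<n. map_mat complex_of_int (circulant_mat a) $$ (r, s) * h i ^ s)
        = ev F (h i) * h i ^ r"
      by (simp add: w_def)
  qed (simp add: circulant_mat_def da)
  also have "\<dots> = (\<Prod>v\<in>{v. v ^ n = 1}. ev F v)"
    by (rule prod.reindex_bij_betw[OF h])
  finally show "of_int (det (circulant_mat a)) = (\<Prod>v\<in>{v. v ^ n = 1}. ev F v)" .
qed

section \<open>Cyclotomic integers modulo a prime\<close>

lemma ev_pcompose: "ev (pcompose f g) z = ev f (ev g z)"
  by (simp add: of_int_hom.map_poly_pcompose poly_pcompose)

lemma ev_monom [simp]: "ev (monom c a) z = of_int c * z ^ a"
  by (simp add: map_poly_monom poly_monom)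

text \<open>The part divisible by \<open>p\<close> is kept explicit, so that its cofactor visibly
  lies in the ring at hand: cyclotomic integers, integers or integer polynomials.\<close>

lemma binomial_prime_power:
  fixes a b :: "'a::comm_ring_1"
  assumes p: "prime p"
  shows "(a + b) ^ p = a ^ p + b ^ p
           + of_nat p * (\<Sum>k\<in>{0<..<p}. of_nat ((p choose k) div p) * a ^ k * b ^ (p - k))"
proof -
  have p0: "p > 0" using p prime_gt_0_nat by blast
  have "{..p} = insert 0 (insert p {0<..<p})" using p0 by auto
  then have "(a + b) ^ p = a ^ p + b ^ p + (\<Sum>k\<in>{0<..<p}. of_nat (p choose k) * a ^ k * b ^ (p - k))"
    using p0 by (simp add: binomial_ring add_ac)
  also have "(\<Sum>k\<in>{0<..<p}. of_nat (p choose k) * a ^ k * b ^ (p - k))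
      = of_nat p * (\<Sum>k\<in>{0<..<p}. of_nat ((p choose k) div p) * a ^ k * b ^ (p - k))"
    unfolding sum_distrib_left
  proof (intro sum.cong refl)
    fix k assume "k \<in> {0<..<p}"
    then have "p dvd (p choose k)" using p by (intro dvd_choose_prime) auto
    then have "of_nat (p choose k) = (of_nat p * of_nat ((p choose k) div p) :: 'a)"
      by (metis dvd_mult_div_cancel of_nat_mult)
    then show "of_nat (p choose k) * a ^ k * b ^ (p - k)
        = (of_nat p * (of_nat ((p choose k) div p) * a ^ k * b ^ (p - k)) :: 'a)"
      by (simp add: mult.assoc)
  qed
  finally show ?thesis .
qed

text \<open>This is the ring generated by all roots of unity. Evaluating at a single root per
  element makes integrality immediate; closure under sums and products then rests on
  \<open>cyc_common\<close>.\<close>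

definition cyc :: "complex set" where
  "cyc = {ev f z | f z. \<exists>d>0. z ^ d = 1}"

lemma root_unity_eq_power:
  assumes "d > 0" "z ^ d = (1::complex)"
  obtains k where "z = cis (2 * pi / d) ^ k"
proof -
  have "z \<in> (\<lambda>k. cis (2 * pi * real k / real d)) ` {..<d}"
    using bij_betw_roots_unity[OF assms(1)] assms(2) by (auto simp: bij_betw_def)
  then obtain k where "z = cis (2 * pi * real k / real d)" by auto
  then have "z = cis (2 * pi / d) ^ k" by (simp add: DeMoivre mult.commute)
  then show ?thesis by (rule that)
qed

text \<open>Roots of orders dividing \<open>d1\<close> and \<open>d2\<close> are powers of one
  primitive root of order \<open>d1 * d2\<close>; composition absorbs the exponents into the
  polynomials.\<close>

lemma cyc_common:
  assumes "x \<in> cyc" "y \<in> cyc"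
  obtains f g z d where "d > 0" "z ^ d = 1" "x = ev f z" "y = ev g z"
proof -
  obtain f1 z1 d1 where 1: "d1 > 0" "z1 ^ d1 = 1" "x = ev f1 z1" using assms by (auto simp: cyc_def)
  obtain f2 z2 d2 where 2: "d2 > 0" "z2 ^ d2 = 1" "y = ev f2 z2" using assms by (auto simp: cyc_def)
  define d where "d = d1 * d2"
  have d: "d > 0" using 1 2 by (simp add: d_def)
  have "z1 ^ d = 1" "z2 ^ d = 1" using 1 2
      by (simp_all add: d_def power_mult) (metis mult.commute power_mult power_one)
  then obtain a b where "z1 = cis (2 * pi / d) ^ a" "z2 = cis (2 * pi / d) ^ b"
    using root_unity_eq_power[OF d] by metis
  then show ?thesis
    using d 1 2 that[of d "cis (2 * pi / d)" "pcompose f1 (monom 1 a)" "pcompose f2 (monom 1 b)"]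
    by (simp add: ev_pcompose DeMoivre poly_monom)
qed

lemma cyc_ev_root: "d > 0 \<Longrightarrow> z ^ d = 1 \<Longrightarrow> ev f z \<in> cyc"
  by (auto simp: cyc_def)

lemma cyc_add [intro]: "x \<in> cyc \<Longrightarrow> y \<in> cyc \<Longrightarrow> x + y \<in> cyc"
  using cyc_common[of x y] by (metis cyc_ev_root of_int_poly_hom.hom_add poly_add)

lemma cyc_mult [intro]: "x \<in> cyc \<Longrightarrow> y \<in> cyc \<Longrightarrow> x * y \<in> cyc"
  using cyc_common[of x y] by (metis cyc_ev_root of_int_poly_hom.hom_mult poly_mult)

lemma cyc_of_int [simp, intro]: "of_int a \<in> cyc"
  using cyc_ev_root[of 1 1 "[:a:]"] by simp

lemma cyc_of_nat [simp, intro]: "of_nat a \<in> cyc"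
  using cyc_of_int[of "int a"] by simp

lemma cyc_0_1 [simp, intro]: "0 \<in> cyc" "1 \<in> cyc"
  using cyc_of_int[of 0] cyc_of_int[of 1] by simp_all

lemma cyc_root: "d > 0 \<Longrightarrow> z ^ d = 1 \<Longrightarrow> z \<in> cyc"
  using cyc_ev_root[of d z "[:0, 1:]"] by simp

lemma cyc_uminus [intro]: "x \<in> cyc \<Longrightarrow> - x \<in> cyc"
  using cyc_mult[OF cyc_of_int[of "-1"]] by auto

lemma cyc_diff [intro]: "x \<in> cyc \<Longrightarrow> y \<in> cyc \<Longrightarrow> x - y \<in> cyc"
  using cyc_add[OF _ cyc_uminus] by fastforce

lemma cyc_power [intro]: "x \<in> cyc \<Longrightarrow> x ^ k \<in> cyc"
  by (induction k) auto

lemma cyc_sum [intro]: "(\<And>i. i \<in> I \<Longrightarrow> f i \<in> cyc) \<Longrightarrow> sum f I \<in> cyc"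
  by (induction I rule: infinite_finite_induct) auto

lemma cyc_prod [intro]: "(\<And>i. i \<in> I \<Longrightarrow> f i \<in> cyc) \<Longrightarrow> prod f I \<in> cyc"
  by (induction I rule: infinite_finite_induct) auto

lemma cyc_ev [intro]: "x \<in> cyc \<Longrightarrow> ev f x \<in> cyc"
  unfolding ev_altdef by (intro cyc_sum cyc_mult cyc_power) auto

lemma cyc_rational_is_int:
  assumes "x \<in> cyc" "x \<in> \<rat>"
  shows "x \<in> \<int>"
  using assms rational_algebraic_int_is_int algebraic_int_ev_root_unity unfolding cyc_def by blast

text \<open>A nonzero \<open>b\<close> makes the quotient a rational algebraic integer, so
  divisibility descends from \<open>cyc\<close> to the integers.\<close>

lemma cyc_dvd_int:
  assumes "of_int a = of_int b * r" "r \<in> cyc"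
  shows "b dvd a"
proof (cases "b = 0")
  case False
  then have "r = of_int a / of_int b" using assms by simp
  then have "r \<in> \<rat>" by simp
  then obtain c where "r = of_int c" using cyc_rational_is_int assms(2) by (auto elim: Ints_cases)
  then have "a = b * c" using assms(1) by (metis of_int_eq_iff of_int_mult)
  then show ?thesis by simp
qed (use assms in auto)

text \<open>The radical of \<open>p\<close> replaces the primes above \<open>p\<close>: it avoids choosing one, and it contains
  \<open>y - 1\<close> for every root of unity \<open>y\<close> of \<open>p\<close>-power order.\<close>

definition rad :: "nat \<Rightarrow> complex set" where
  "rad p = {x \<in> cyc. \<exists>N. \<exists>r\<in>cyc. x ^ N = of_nat p * r}"

lemma radI: "x \<in> cyc \<Longrightarrow> r \<in> cyc \<Longrightarrow> x ^ N = of_nat p * r \<Longrightarrow> x \<in> rad p"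
  by (auto simp: rad_def)

lemma rad_cyc: "x \<in> rad p \<Longrightarrow> x \<in> cyc"
  by (auto simp: rad_def)

lemma rad_mult:
  assumes "x \<in> rad p" "r \<in> cyc"
  shows "x * r \<in> rad p"
proof -
  obtain N s where "s \<in> cyc" "x ^ N = of_nat p * s" using assms(1) by (auto simp: rad_def)
  then show ?thesis using assms rad_cyc
    by (intro radI[of _ "s * r ^ N" N]) (auto simp: power_mult_distrib)
qed

lemma rad_mult': "x \<in> rad p \<Longrightarrow> r \<in> cyc \<Longrightarrow> r * x \<in> rad p"
  using rad_mult by (metis mult.commute)

text \<open>Every term of \<open>(x + y)^(N + M)\<close> contains \<open>x^N\<close> or
  \<open>y^M\<close>, hence a factor \<open>p\<close>; \<open>t k\<close> is the remaining
  cofactor.\<close>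

lemma rad_add:
  assumes "x \<in> rad p" "y \<in> rad p"
  shows "x + y \<in> rad p"
proof -
  obtain N r where 1: "r \<in> cyc" "x ^ N = of_nat p * r" using assms(1) by (auto simp: rad_def)
  obtain M s where 2: "s \<in> cyc" "y ^ M = of_nat p * s" using assms(2) by (auto simp: rad_def)
  have xy: "x \<in> cyc" "y \<in> cyc" using assms rad_cyc by auto
  define t where "t k = of_nat (N + M choose k) * (if N \<le> k then r * x ^ (k - N) * y ^ (N + M - k)
     else s * x ^ k * y ^ (N - k))" for k
  have "(x + y) ^ (N + M) = (\<Sum>k\<le>N + M. of_nat p * t k)"
    unfolding binomial_ring
  proof (intro sum.cong refl)
    fix k assume k: "k \<in> {..N + M}"
    have "x ^ k * y ^ (N + M - k) = of_nat p * (if N \<le> k then r * x ^ (k - N) * y ^ (N + M - k)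
       else s * x ^ k * y ^ (N - k))"
    proof (cases "N \<le> k")
      case True
      then have "x ^ k = x ^ N * x ^ (k - N)" by (simp flip: power_add)
      then show ?thesis using True 1(2) by simp
    next
      case False
      then have "y ^ (N + M - k) = y ^ M * y ^ (N - k)" by (simp add: add.commute flip: power_add)
      then show ?thesis using False 2(2) by simp
    qed
    then show "of_nat (N + M choose k) * x ^ k * y ^ (N + M - k) = of_nat p * t k"
      by (simp add: t_def mult_ac)
  qed
  also have "\<dots> = of_nat p * (\<Sum>k\<le>N + M. t k)" by (simp add: sum_distrib_left)
  finally have "(x + y) ^ (N + M) = of_nat p * (\<Sum>k\<le>N + M. t k)" .
  moreover have "t k \<in> cyc" for k
    using xy 1(1) 2(1) by (cases "N \<le> k") (auto simp: t_def)
  ultimately show ?thesis using xy by (intro radI[of _ "\<Sum>k\<le>N + M. t k"]) auto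
qed

lemma rad_uminus: "x \<in> rad p \<Longrightarrow> - x \<in> rad p"
  using rad_mult[OF _ cyc_of_int[of "-1"]] by fastforce

lemma rad_diff: "x \<in> rad p \<Longrightarrow> y \<in> rad p \<Longrightarrow> x - y \<in> rad p"
  using rad_add[OF _ rad_uminus] by fastforce

lemma rad_0 [simp]: "0 \<in> rad p"
  by (rule radI[of _ 0 1]) auto

lemma rad_multiple: "r \<in> cyc \<Longrightarrow> of_nat p * r \<in> rad p"
  by (rule radI[of _ r 1]) auto

lemma rad_power: "x \<in> cyc \<Longrightarrow> x ^ k \<in> rad p \<Longrightarrow> x \<in> rad p"
  by (auto simp: rad_def power_mult[symmetric])

lemma rad_of_int_iff:
  assumes p: "prime p"
  shows "of_int a \<in> rad p \<longleftrightarrow> int p dvd a"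
proof
  assume "of_int a \<in> rad p"
  then obtain N r where "r \<in> cyc" "of_int a ^ N = of_nat p * r" by (auto simp: rad_def)
  then have "int p dvd a ^ N" by (intro cyc_dvd_int[of _ _ r]) auto
  then show "int p dvd a" using p prime_dvd_power[of "int p"] by simp
next
  assume "int p dvd a"
  then obtain c where "a = int p * c" by (elim dvdE)
  then show "of_int a \<in> rad p" using rad_multiple[OF cyc_of_int, of p c] by simp
qed

text \<open>Modulo \<open>p\<close>, \<open>(y - 1)^p\<close> equals \<open>y^p - 1\<close> because
  \<open>p\<close> is odd, and the radical is closed under taking roots; this lowers
  \<open>j\<close> by one.\<close>

lemma rad_root_minus_1:
  assumes p: "prime p" "odd p"
  shows "y ^ (p ^ j) = 1 \<Longrightarrow> y - 1 \<in> rad p"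
proof (induction j arbitrary: y)
  case (Suc j)
  have p0: "p > 0" using p prime_gt_0_nat by blast
  have yc: "y \<in> cyc" using Suc.prems p0 by (intro cyc_root[of "p ^ Suc j"]) auto
  have "(y ^ p) ^ (p ^ j) = 1" using Suc.prems by (simp add: power_mult)
  then have *: "y ^ p - 1 \<in> rad p" by (rule Suc.IH)
  define S where "S = (\<Sum>k\<in>{0<..<p}. of_nat ((p choose k) div p) * y ^ k * (- 1) ^ (p - k))"
  have "S \<in> cyc" unfolding S_def using yc by (intro cyc_sum cyc_mult cyc_power cyc_uminus) auto
  then have "of_nat p * S \<in> rad p" by (rule rad_multiple)
  moreover have "(y - 1) ^ p = (y ^ p - 1) + of_nat p * S"
    using binomial_prime_power[OF p(1), of y "-1"] p(2) by (simp add: S_def)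
  ultimately have "(y - 1) ^ p \<in> rad p" using rad_add[OF *] by simp
  then show ?case using yc rad_power by blast
qed auto

lemma rad_cong_mult:
  assumes "x - x' \<in> rad p" "y - y' \<in> rad p" "x' \<in> cyc" "y \<in> cyc"
  shows "x * y - x' * y' \<in> rad p"
proof -
  have "(x - x') * y + x' * (y - y') \<in> rad p"
    using assms by (intro rad_add rad_mult rad_mult')
  then show ?thesis by (simp add: algebra_simps)
qed

lemma rad_cong_power:
  assumes "x - y \<in> rad p" "x \<in> cyc" "y \<in> cyc"
  shows "x ^ k - y ^ k \<in> rad p"
  by (induction k) (use assms in \<open>auto intro!: rad_cong_mult\<close>)

lemma rad_cong_prod:
  assumes "\<And>i. i \<in> I \<Longrightarrow> f i - g i \<in> rad p" "\<And>i. i \<in> I \<Longrightarrow> f i \<in> cyc" "\<And>i. i \<in> I \<Longrightarrow> g i \<in> cyc"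
  shows "prod f I - prod g I \<in> rad p"
  using assms
  by (induction I rule: infinite_finite_induct) (auto intro!: rad_cong_mult)

lemma rad_sum: "(\<And>i. i \<in> I \<Longrightarrow> f i \<in> rad p) \<Longrightarrow> sum f I \<in> rad p"
  by (induction I rule: infinite_finite_induct) (auto intro!: rad_add)

lemma rad_cong_ev:
  assumes "x - y \<in> rad p" "x \<in> cyc" "y \<in> cyc"
  shows "ev F x - ev F y \<in> rad p"
proof -
  have "ev F x - ev F y = (\<Sum>t\<le>degree F. of_int (coeff F t) * (x ^ t - y ^ t))"
    by (simp add: ev_altdef sum_subtractf algebra_simps)
  then show ?thesis using rad_cong_power[OF assms] by (auto intro!: rad_sum rad_mult')
qed

text \<open>\<open>u\<close> divides an integer prime to \<open>p\<close>, so Bezout gives an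
  inverse of \<open>u\<close> modulo \<open>p\<close>.\<close>

lemma rad_cancel:
  assumes "x * u \<in> rad p" "u * r = of_int a" "x \<in> cyc" "r \<in> cyc" "coprime a (int p)"
  shows "x \<in> rad p"
proof -
  obtain s t where st: "s * a + t * int p = 1"
    using bezout_int[of a "int p"] assms(5) by auto
  have "x * u * (r * of_int s) + of_nat p * (x * of_int t) \<in> rad p"
    using assms by (intro rad_add rad_mult[OF assms(1)] rad_multiple) auto
  also have "x * u * (r * of_int s) + of_nat p * (x * of_int t)
      = x * (of_int s * (u * r) + of_int t * of_nat p)"
    by (simp add: algebra_simps)
  also have "\<dots> = x * of_int (s * a + t * int p)" using assms(2) by simp
  finally show ?thesis using st by simp
qed

text \<open>The source of the final contradictions: otherwise -1 would be congruent to a power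
  \<open>u\<close> of \<open>y\<close>, and raising to the odd exponent \<open>m\<close> would put 2
  into the radical.\<close>

lemma sum_root_unity_not_in_rad:
  assumes q: "prime q" "odd q" and m: "odd m" "y ^ m = 1"
  shows "y ^ a + y ^ b \<notin> rad q"
proof
  assume *: "y ^ a + y ^ b \<in> rad q"
  have m0: "m > 0" using m by (intro Nat.gr0I) auto
  have yc: "y \<in> cyc" using m m0 cyc_root by blast
  define u where "u = y ^ a * y ^ ((m - 1) * b)"
  have "b + (m - 1) * b = m * b" using m0 by (metis add.commute mult_eq_if not_gr0)
  then have yb: "y ^ b * y ^ ((m - 1) * b) = 1" using m(2) by (metis power_add power_mult power_one)
  have "(y ^ a + y ^ b) * y ^ ((m - 1) * b) \<in> rad q" using * yc by (intro rad_mult) auto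
  also have "(y ^ a + y ^ b) * y ^ ((m - 1) * b) = u - (-1)"
    using yb by (simp add: distrib_right u_def)
  finally have "u ^ m - (-1) ^ m \<in> rad q"
    using yc by (intro rad_cong_power) (auto simp: u_def)
  moreover have "u ^ m = 1"
    unfolding u_def by (metis m(2) mult.commute power_add power_mult power_one)
  ultimately have "of_int 2 \<in> rad q" using m(1) by simp
  then have "int q dvd 2" using rad_of_int_iff[OF q(1)] by blast
  then have "q dvd 2" by presburger
  then have "q = 2" using q(1) primes_dvd_imp_eq two_is_prime_nat by blast
  then show False using q(2) by simp
qed

section \<open>Primitive roots of unity\<close>

text \<open>Numbers of exact order \<open>d\<close>. For \<open>d = 0\<close> the condition picks
  the numbers that are not roots of unity, hence the recurring assumption
  \<open>d > 0\<close>.\<close>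

definition prim :: "nat \<Rightarrow> complex set" where
  "prim d = {z. \<forall>k. z ^ k = 1 \<longleftrightarrow> d dvd k}"

lemma prim_power_eq_1_iff: "z \<in> prim d \<Longrightarrow> z ^ k = 1 \<longleftrightarrow> d dvd k"
  by (simp add: prim_def)

lemma prim_power_self: "z \<in> prim d \<Longrightarrow> z ^ d = 1"
  by (simp add: prim_def)

lemma finite_roots [simp]: "d > 0 \<Longrightarrow> finite {z::complex. z ^ d = 1}"
  using card_power_eq[of d 1] by simp

lemma finite_prim [simp]: "d > 0 \<Longrightarrow> finite (prim d)"
  by (rule finite_subset[of _ "{z. z ^ d = 1}"]) (auto simp: prim_power_self)

lemma prim_cyc: "d > 0 \<Longrightarrow> z \<in> prim d \<Longrightarrow> z \<in> cyc"
  using cyc_root prim_power_self by blast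

lemma prim_disjoint: "z \<in> prim d \<Longrightarrow> z \<in> prim e \<Longrightarrow> d = e"
  by (metis prim_power_eq_1_iff dvd_antisym dvd_refl)

lemma root_unity_in_prim:
  assumes "n > 0" "z ^ n = (1::complex)"
  obtains d where "d > 0" "d dvd n" "z \<in> prim d"
proof -
  define d where "d = (LEAST d. d > 0 \<and> z ^ d = 1)"
  have d: "d > 0 \<and> z ^ d = 1" unfolding d_def by (rule LeastI[of _ n]) (use assms in auto)
  have "d dvd k" if "z ^ k = 1" for k
  proof -
    have "z ^ k = z ^ (d * (k div d) + k mod d)" by simp
    also have "\<dots> = z ^ (k mod d)" using d by (simp only: power_add power_mult) simp
    finally have "z ^ (k mod d) = 1" using that by simp
    then have "\<not> k mod d > 0"
      using not_less_Least[of "k mod d" "\<lambda>d. d > 0 \<and> z ^ d = 1"] d by (auto simp flip: d_def)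
    then show ?thesis by auto
  qed
  moreover have "z ^ k = 1" if "d dvd k" for k using that d by (auto simp: power_mult)
  ultimately have "z \<in> prim d" by (auto simp: prim_def)
  then show ?thesis using d assms prim_power_eq_1_iff by (intro that[of d]) auto
qed

lemma prod_roots_eq_prod_prim:
  assumes "n > 0"
  shows "(\<Prod>z\<in>{z. z ^ n = 1}. f z) = (\<Prod>d\<in>{d. d dvd n}. \<Prod>z\<in>prim d. f z :: complex)"
proof -
  have "{z. z ^ n = 1} = (\<Union>d\<in>{d. d dvd n}. prim d)"
  proof (intro equalityI subsetI)
    fix z :: complex assume "z \<in> {z. z ^ n = 1}"
    then obtain d where "d dvd n" "z \<in> prim d" using root_unity_in_prim[OF assms] by blast
    then show "z \<in> (\<Union>d\<in>{d. d dvd n}. prim d)" by blast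
  qed (use prim_power_eq_1_iff in blast)
  moreover have "finite (prim d)" if "d dvd n" for d
    using that assms by (intro finite_prim) (auto intro!: Nat.gr0I)
  ultimately show ?thesis using assms prim_disjoint
    by (simp add: prod.UNION_disjoint disjoint_iff) (subst prod.UNION_disjoint, auto)
qed

lemma cis_in_prim:
  assumes d: "d > 0"
  shows "cis (2 * pi / d) \<in> prim d"
proof -
  define w where "w = cis (2 * pi / d)"
  have wd: "w ^ d = 1" using d by (simp add: w_def DeMoivre)
  have "d dvd k" if "w ^ k = 1" for k
  proof -
    have "w ^ k = w ^ (d * (k div d) + k mod d)" by simp
    also have "\<dots> = w ^ (k mod d)" using wd by (simp only: power_add power_mult) simp
    also have "\<dots> = cis (2 * pi * real (k mod d) / real d)"
        by (simp add: w_def DeMoivre mult.commute)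
    finally have "cis (2 * pi * real (k mod d) / real d) = cis (2 * pi * real 0 / real d)"
        using that by simp
    then have "k mod d = 0"
      using inj_onD[OF bij_betw_imp_inj_on[OF bij_betw_roots_unity[OF d]]] d by force
    then show ?thesis by auto
  qed
  moreover have "w ^ k = 1" if "d dvd k" for k using that wd by (auto simp: power_mult)
  ultimately show ?thesis by (auto simp: prim_def w_def)
qed

lemma prim_powers:
  assumes d: "d > 0" and w: "w \<in> prim d"
  shows "bij_betw (\<lambda>k. w ^ k) {0<..d} {z. z ^ d = 1}"
proof -
  have wd: "w ^ d = 1" using w by (rule prim_power_self)
  have w0: "w \<noteq> 0" using wd d by (auto simp: power_0_left)
  have *: "i = j" if "i \<le> j" "i \<in> {0<..d}" "j \<in> {0<..d}" "w ^ i = w ^ j" for i j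
  proof -
    have "w ^ j = w ^ i * w ^ (j - i)" using that(1) by (simp flip: power_add)
    then have "w ^ (j - i) = 1" using that w0 by simp
    then have "d dvd j - i" using w prim_power_eq_1_iff by simp
    then show ?thesis using that by (auto dest!: dvd_imp_le)
  qed
  have inj: "inj_on (\<lambda>k. w ^ k) {0<..d}"
    by (rule inj_onI) (metis * nat_le_linear)
  have "(\<lambda>k. w ^ k) ` {0<..d} = {z. z ^ d = 1}"
  proof (rule card_subset_eq)
    show "(\<lambda>k. w ^ k) ` {0<..d} \<subseteq> {z. z ^ d = 1}"
      using wd by (auto simp: power_mult[symmetric]) (metis mult.commute power_mult power_one)
    show "card ((\<lambda>k. w ^ k) ` {0<..d}) = card {z::complex. z ^ d = 1}"
      using card_image[OF inj] card_power_eq[OF d, of 1] by simp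
  qed (use d in simp)
  then show ?thesis using inj by (simp add: bij_betw_def)
qed

lemma prim_power:
  assumes w: "w \<in> prim d" and k: "coprime k d"
  shows "w ^ k \<in> prim d"
proof -
  have "(w ^ k) ^ m = 1 \<longleftrightarrow> d dvd m" for m
  proof -
    have "(w ^ k) ^ m = 1 \<longleftrightarrow> d dvd k * m"
      using prim_power_eq_1_iff[OF w, of "k * m"] by (simp add: power_mult)
    then show ?thesis using k by (simp add: coprime_dvd_mult_right_iff coprime_commute)
  qed
  then show ?thesis by (simp add: prim_def)
qed

lemma prim_totatives:
  assumes d: "d > 0" and w: "w \<in> prim d"
  shows "bij_betw (\<lambda>k. w ^ k) (totatives d) (prim d)"
proof -
  have "(\<lambda>k. w ^ k) ` totatives d = prim d"
  proof (intro equalityI subsetI)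
    fix z assume z: "z \<in> prim d"
    then have "z \<in> (\<lambda>k. w ^ k) ` {0<..d}"
      using prim_powers[OF d w] prim_power_self by (auto simp: bij_betw_def)
    then obtain k where k: "k \<in> {0<..d}" "z = w ^ k" by auto
    \<comment> \<open>With \<open>d = g * d'\<close> the power \<open>z ^ d'\<close> is 1, so exact
      order \<open>d\<close> forces \<open>g = 1\<close>.\<close>
    define g where "g = gcd k d"
    obtain k' d' where kd: "k = g * k'" "d = g * d'"
      unfolding g_def by (meson dvdE gcd_dvd1 gcd_dvd2)
    have "z ^ d' = w ^ (d * k')" by (simp add: k(2) kd mult_ac flip: power_mult)
    also have "\<dots> = 1" using prim_power_eq_1_iff[OF w] by simp
    finally have "g * d' dvd 1 * d'" using prim_power_eq_1_iff[OF z] by (simp flip: kd(2))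
    moreover have "d' \<noteq> 0" using kd(2) d by auto
    ultimately have "g \<le> 1" by (auto dest!: dvd_imp_le)
    moreover have "g > 0" using d by (simp add: g_def)
    ultimately have "g = 1" by simp
    then have "gcd k d = 1" by (simp only: g_def)
    then have "coprime k d" by (simp add: coprime_iff_gcd_eq_1)
    then show "z \<in> (\<lambda>k. w ^ k) ` totatives d" using k by (auto simp: in_totatives_iff)
  qed (use w in \<open>auto simp: in_totatives_iff intro!: prim_power\<close>)
  moreover have "inj_on (\<lambda>k. w ^ k) (totatives d)"
    by (rule inj_on_subset[OF bij_betw_imp_inj_on[OF prim_powers[OF d w]] totatives_subset])
  ultimately show ?thesis by (simp add: bij_betw_def)
qed

lemma prim_mult:
  assumes "coprime a b" "x \<in> prim a" "y \<in> prim b"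
  shows "x * y \<in> prim (a * b)"
proof -
  have "(x * y) ^ k = 1 \<longleftrightarrow> a * b dvd k" for k
  proof
    assume *: "(x * y) ^ k = 1"
    have "1 = ((x * y) ^ k) ^ a" using * by simp
    also have "\<dots> = (x ^ a) ^ k * y ^ (a * k)"
        by (simp add: power_mult_distrib mult.commute flip: power_mult)
    finally have "b dvd a * k" using assms prim_power_eq_1_iff prim_power_self
        by (metis mult_1 power_one)
    then have b: "b dvd k" using assms(1) by (simp add: coprime_dvd_mult_right_iff coprime_commute)
    have "1 = ((x * y) ^ k) ^ b" using * by simp
    also have "\<dots> = (y ^ b) ^ k * x ^ (b * k)"
        by (simp add: power_mult_distrib mult.commute flip: power_mult)
    finally have "a dvd b * k" using assms prim_power_eq_1_iff prim_power_self
        by (metis mult_1 power_one)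
    then have "a dvd k" using assms(1) by (simp add: coprime_dvd_mult_right_iff)
    with b show "a * b dvd k" using assms(1) by (simp add: divides_mult)
  next
    assume "a * b dvd k"
    then have "a dvd k" "b dvd k" by (auto dest: dvd_mult_left dvd_mult_right)
    then have "x ^ k = 1" "y ^ k = 1"
      using assms(2,3) by (auto simp: prim_def)
    then show "(x * y) ^ k = 1" by (simp add: power_mult_distrib)
  qed
  then show ?thesis by (simp add: prim_def)
qed

lemma root_power_cong:
  assumes "[i = j] (mod d)" "z ^ d = (1::complex)"
  shows "z ^ i = z ^ j"
proof -
  have *: "z ^ i = z ^ (i mod d)" for i
  proof -
    have "z ^ i = z ^ (d * (i div d) + i mod d)" by simp
    then show ?thesis using assms(2) by (simp only: power_add power_mult) simp
  qed
  show ?thesis using *[of i] *[of j] assms(1) by (simp add: cong_def)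
qed

text \<open>Chinese remaindering on exponents: \<open>s\<close> and \<open>t\<close> are
  complementary idempotents modulo \<open>a * b\<close>, so \<open>z = z^s * z^t\<close> splits
  \<open>z\<close> into its two components.\<close>

lemma prim_mult_bij:
  assumes c: "coprime a b"
  shows "bij_betw (\<lambda>(x, y). x * y) (prim a \<times> prim b) (prim (a * b))"
proof -
  obtain s where s: "[s = 1] (mod a)" "[s = 0] (mod b)"
    using binary_chinese_remainder_nat[OF c] by blast
  obtain t where t: "[t = 0] (mod a)" "[t = 1] (mod b)"
    using binary_chinese_remainder_nat[OF c] by blast
  have cs: "coprime s a" "b dvd s" and ct: "coprime t b" "a dvd t"
    using cong_imp_coprime[OF cong_sym[OF s(1)]] cong_imp_coprime[OF cong_sym[OF t(2)]] s t
    by (auto simp: cong_0_iff)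
  show ?thesis
  proof (rule bij_betwI[where g = "\<lambda>z. (z ^ s, z ^ t)"])
    show "(\<lambda>(x, y). x * y) \<in> prim a \<times> prim b \<rightarrow> prim (a * b)"
      using prim_mult[OF c] by auto
    show "(\<lambda>z. (z ^ s, z ^ t)) \<in> prim (a * b) \<rightarrow> prim a \<times> prim b"
    proof (rule funcsetI)
      fix z assume z: "z \<in> prim (a * b)"
      have "(z ^ s) ^ k = 1 \<longleftrightarrow> a dvd k" for k
      proof -
        have "(z ^ s) ^ k = 1 \<longleftrightarrow> a * b dvd s * k"
          using prim_power_eq_1_iff[OF z, of "s * k"] by (simp add: power_mult)
        also have "\<dots> \<longleftrightarrow> a dvd s * k"
          using cs(2) c by (meson dvd_mult2 dvd_mult_left divides_mult)
        finally show ?thesis using cs(1) by (simp add: coprime_dvd_mult_right_iff coprime_commute)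
      qed
      moreover have "(z ^ t) ^ k = 1 \<longleftrightarrow> b dvd k" for k
      proof -
        have "(z ^ t) ^ k = 1 \<longleftrightarrow> a * b dvd t * k"
          using prim_power_eq_1_iff[OF z, of "t * k"] by (simp add: power_mult)
        also have "\<dots> \<longleftrightarrow> b dvd t * k"
          using ct(2) c by (meson dvd_mult2 dvd_mult_right divides_mult)
        finally show ?thesis using ct(1) by (simp add: coprime_dvd_mult_right_iff coprime_commute)
      qed
      ultimately show "(z ^ s, z ^ t) \<in> prim a \<times> prim b" by (simp add: prim_def)
    qed
    show "(\<lambda>z. (z ^ s, z ^ t)) (case z of (x, y) \<Rightarrow> x * y) = z" if zz: "z \<in> prim a \<times> prim b" for z
    proof -
      obtain x y where z: "z = (x, y)" "x \<in> prim a" "y \<in> prim b" using zz by auto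
      have "x ^ s = x" "y ^ s = 1" "x ^ t = 1" "y ^ t = y"
        using root_power_cong[OF s(1)] root_power_cong[OF s(2)] root_power_cong[OF t(1)]
            root_power_cong[OF t(2)]
          z prim_power_self by auto
      then show ?thesis by (simp add: z power_mult_distrib)
    qed
    show "(case (z ^ s, z ^ t) of (x, y) \<Rightarrow> x * y) = z" if z: "z \<in> prim (a * b)" for z
    proof -
      have "[s + t = 1] (mod a)" "[s + t = 1] (mod b)"
        using cong_add[OF s(1) t(1)] cong_add[OF s(2) t(2)] by auto
      then have "[s + t = 1] (mod (a * b))" using c by (intro coprime_cong_mult_nat) auto
      then have "z ^ (s + t) = z ^ 1" using root_power_cong prim_power_self[OF z] by blast
      then show ?thesis by (simp add: power_add)
    qed
  qed
qed

lemma prod_prim_mult: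
  assumes "coprime a b"
  shows "(\<Prod>z\<in>prim (a * b). f z) = (\<Prod>x\<in>prim a. \<Prod>y\<in>prim b. f (x * y) :: complex)"
  using prod.reindex_bij_betw[OF prim_mult_bij[OF assms], of f]
  by (simp add: prod.cartesian_product split_def)

lemma root_cnj:
  assumes "d > 0" "z ^ d = 1"
  shows "cmod z = 1" "z * cnj z = 1" "cnj z = z ^ (d - 1)"
proof -
  show 1: "cmod z = 1" 
  proof (rule power_eq_imp_eq_base)
    show "cmod z ^ d = 1 ^ d" using assms by (metis norm_one norm_power power_one)
  qed (use assms in auto)
  show 2: "z * cnj z = 1" using 1 complex_norm_square[of z] by simp
  have "z * z ^ (d - 1) = 1" using assms by (simp flip: power_Suc)
  then have "z * (cnj z - z ^ (d - 1)) = 0" using 2 by (simp add: right_diff_distrib)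
  then show "cnj z = z ^ (d - 1)" using 2 by auto
qed

lemma prim_cnj: "z \<in> prim d \<Longrightarrow> cnj z \<in> prim d"
  by (simp add: prim_def flip: complex_cnj_power)

lemma ev_cnj: "ev F (cnj z) = cnj (ev F z)"
  by (simp add: ev_altdef)

section \<open>Integrality and size of polynomial values at roots of unity\<close>

lemma sum_root_powers:
  assumes d: "d > 0"
  shows "(\<Sum>v\<in>{v::complex. v ^ d = 1}. v ^ t) = (if d dvd t then of_nat d else 0)"
proof (cases "d dvd t")
  case True
  then have "v ^ t = 1" if "v ^ d = 1" for v :: complex using that by (auto simp: power_mult)
  then show ?thesis using True card_power_eq[OF d, of 1] by simp
next
  case False
  define w where "w = cis (2 * pi / d)"
  have w: "w \<in> prim d" unfolding w_def by (rule cis_in_prim[OF d])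
  have wt: "w ^ t \<noteq> 1" using False w prim_power_eq_1_iff by blast
  have w0: "w \<noteq> 0" using w wt prim_power_self d by (metis power_0_left less_irrefl zero_neq_one)
  have "bij_betw (\<lambda>v. w * v) {v. v ^ d = 1} {v. v ^ d = 1}"
    by (rule bij_betwI[where g = "\<lambda>v. v / w"])
      (use prim_power_self[OF w] w0 in \<open>auto simp: power_mult_distrib power_divide\<close>)
  from sum.reindex_bij_betw[OF this, of "\<lambda>v. v ^ t"]
  have "w ^ t * (\<Sum>v\<in>{v. v ^ d = 1}. v ^ t) = (\<Sum>v\<in>{v. v ^ d = 1}. v ^ t)"
    by (simp add: power_mult_distrib sum_distrib_left)
  then show ?thesis using wt False by simp
qed

lemma sum_ev_roots:
  assumes d: "d > 0"
  obtains c :: int where "(\<Sum>v\<in>{v. v ^ d = 1}. ev f v) = of_nat d * of_int c"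
proof
  have "(\<Sum>v\<in>{v. v ^ d = 1}. ev f v) = (\<Sum>t\<le>degree f. of_int (coeff f t) * (\<Sum>v\<in>{v. v ^ d
      = 1}. v ^ t))"
    unfolding ev_altdef by (subst sum.swap) (simp add: sum_distrib_left)
  also have "\<dots> = (\<Sum>t\<le>degree f. of_nat d * of_int (if d dvd t then coeff f t else 0))"
    by (intro sum.cong refl) (simp add: sum_root_powers[OF d])
  also have "\<dots> = of_nat d * of_int (\<Sum>t\<le>degree f. if d dvd t then coeff f t else 0)"
    by (simp add: sum_distrib_left)
  finally show "(\<Sum>v\<in>{v. v ^ d = 1}. ev f v) = of_nat d * of_int (\<Sum>t\<le>degree f.
      if d dvd t then coeff f t else 0)" .
qed

text \<open>The mean of the squared moduli over all \<open>d\<close>-th roots of unity is an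
  integer; being at least 0 and below 1, it is 0.\<close>

lemma ev_small_roots_eq_0:
  assumes d: "d > 0" and small: "\<And>v. v ^ d = 1 \<Longrightarrow> cmod (ev f v) < 1" and v: "v ^ d = 1"
  shows "ev f v = 0"
proof -
  let ?U = "{v::complex. v ^ d = 1}"
  \<comment> \<open>On \<open>d\<close>-th roots of unity \<open>x^(d-1)\<close> is complex
    conjugation, so \<open>g\<close> takes the values \<open>|f(v)|^2\<close>.\<close>
  define g where "g = f * pcompose f (monom 1 (d - 1))"
  obtain c where c: "(\<Sum>v\<in>?U. ev g v) = of_nat d * of_int c" using sum_ev_roots[OF d] by blast
  have "ev g v = of_real ((cmod (ev f v))\<^sup>2)" if "v ^ d = 1" for v
  proof -
    have "ev g v = ev f v * ev f (cnj v)"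
      using root_cnj(3)[OF d that] by
          (simp add: g_def of_int_poly_hom.hom_mult ev_pcompose poly_monom)
    then show ?thesis by (simp only: ev_cnj complex_norm_square)
  qed
  then have "(\<Sum>v\<in>?U. ev g v) = of_real (\<Sum>v\<in>?U. (cmod (ev f v))\<^sup>2)" by simp
  then have "complex_of_real (\<Sum>v\<in>?U. (cmod (ev f v))\<^sup>2) = complex_of_real (real d * real_of_int c)"
    using c by simp
  then have eq: "(\<Sum>v\<in>?U. (cmod (ev f v))\<^sup>2) = real d * real_of_int c"
    by (simp only: of_real_eq_iff)
  have "(\<Sum>v\<in>?U. (cmod (ev f v))\<^sup>2) < (\<Sum>v\<in>?U. 1)"
    using v d small by (intro sum_strict_mono) (auto simp: power_less_one_iff abs_square_less_1)
  then have "real d * real_of_int c < real d * 1" using eq card_power_eq[OF d, of 1] by simp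
  then have "c < 1" using d by simp
  moreover have "real d * real_of_int c \<ge> 0" unfolding eq[symmetric] by (intro sum_nonneg) auto
  then have "c \<ge> 0" using d by (simp add: zero_le_mult_iff)
  ultimately have "(\<Sum>v\<in>?U. (cmod (ev f v))\<^sup>2) = 0" using eq by simp
  then have "\<forall>v\<in>?U. (cmod (ev f v))\<^sup>2 = 0" using d by (subst (asm) sum_nonneg_eq_0_iff) auto
  then show ?thesis using v by simp
qed

text \<open>Only the primitive roots are controlled here, so \<open>h\<^sup>N\<close> is multiplied by a fixed polynomial \<open>E\<close>
  that vanishes at the other \<open>d\<close>-th roots of unity; \<open>E h\<^sup>N\<close> is small at all of them for large \<open>N\<close>.\<close>

lemma ev_small_prim_eq_0:
  assumes d: "d > 0" and small: "\<And>v. v \<in> prim d \<Longrightarrow> cmod (ev h v) < 1" and v: "v \<in> prim d"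
  shows "ev h v = 0"
proof -
  define E where "E = (\<Prod>e\<in>{e. e dvd d \<and> e < d}. monom 1 e - 1 :: int poly)"
  have E: "ev E v = (\<Prod>e\<in>{e. e dvd d \<and> e < d}. v ^ e - 1)" for v
    by (simp add: E_def of_int_poly_hom.hom_prod poly_prod hom_distribs poly_monom)
  have "((\<lambda>N. cmod (ev E v) * cmod (ev h v) ^ N) \<longlongrightarrow> cmod (ev E v) * 0) sequentially"
      if "v \<in> prim d" for v
    using small[OF that] by (intro tendsto_mult tendsto_const LIMSEQ_power_zero) auto
  then have "\<forall>\<^sub>F N in sequentially. cmod (ev E v) * cmod (ev h v) ^ N < 1" if "v \<in> prim d" for v
    using order_tendstoD(2)[of _ _ _ 1] that by fastforce
  then have "\<forall>\<^sub>F N in sequentially. \<forall>v\<in>prim d. cmod (ev E v) * cmod (ev h v) ^ N < 1"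
    using d by (intro eventually_ball_finite) auto
  then obtain N where N: "\<And>v. v \<in> prim d \<Longrightarrow> cmod (ev E v) * cmod (ev h v) ^ N < 1"
    by (auto simp: eventually_sequentially)
  define f where "f = E * h ^ N"
  have f: "ev f v = ev E v * ev h v ^ N" for v
    by (simp add: f_def hom_distribs)
  have "cmod (ev f v) < 1" if vd: "v ^ d = 1" for v
  proof (cases "v \<in> prim d")
    case True
    then show ?thesis using N by (simp add: f norm_mult norm_power)
  next
    case False
    obtain e where e: "e > 0" "e dvd d" "v \<in> prim e" using root_unity_in_prim[OF d vd] by blast
    then have "e < d" using False d by (metis dvd_imp_le le_neq_implies_less)
    then have "ev E v = 0" using e d prim_power_self unfolding E
      by (intro prod_zero) auto
    then show ?thesis by (simp add: f)
  qed
  then have "ev f v = 0" using ev_small_roots_eq_0[OF d] prim_power_self[OF v] by blast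
  moreover have "ev E v \<noteq> 0"
    unfolding E using d prim_power_eq_1_iff[OF v] by (auto dest: dvd_antisym)
  ultimately show ?thesis by (simp add: f)
qed

section \<open>Kronecker's theorem\<close>

lemma fermat_dvd:
  assumes l: "prime l" "odd l"
  shows "int l dvd a ^ l - a"
proof -
  have *: "int l dvd int k ^ l - int k" for k
  proof (induction k)
    case 0
    then show ?case using l by (auto simp: power_0_left)
  next
    case (Suc k)
    have eq: "(int k + 1) ^ l - (int k + 1)
        = (int k ^ l - int k) + int l * (\<Sum>i\<in>{0<..<l}. int ((l choose i) div l) * int k ^ i * 1 ^
        (l - i))"
      using binomial_prime_power[OF l(1), of "int k" 1] by simp
    have "int l dvd (int k + 1) ^ l - (int k + 1)"
      unfolding eq by (intro dvd_add Suc.IH dvd_triv_left)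
    then show ?case by (simp add: add.commute)
  qed
  show ?thesis
  proof (cases "a \<ge> 0")
    case True
    then show ?thesis using *[of "nat a"] by simp
  next
    case False
    then have "int l dvd (- a) ^ l - (- a)" using *[of "nat (- a)"] by simp
    then have "int l dvd - ((- a) ^ l - (- a))" by (simp only: dvd_minus_iff)
    then show ?thesis using l(2) by simp
  qed
qed

text \<open>Induction on the coefficients: Fermat's little theorem handles the constant term,
  divisibility of the binomial coefficients the mixed terms.\<close>

lemma frobenius_poly:
  assumes l: "prime l" "odd l"
  shows "of_nat l dvd g ^ l - pcompose g (monom 1 l :: int poly)"
proof (induction g)
  case 0
  then show ?case using l by (auto simp: power_0_left)
next
  case (pCons a g)
  define X where "X = (monom 1 1 :: int poly)"
  define S where "S = (\<Sum>k\<in>{0<..<l}. of_nat ((l choose k) div l) * [:a:] ^ k * (X * g) ^ (l - k))"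
  obtain c where c: "a ^ l - a = int l * c" using fermat_dvd[OF l] by blast
  obtain h where h: "g ^ l - pcompose g (monom 1 l) = of_nat l * h" using pCons.IH by blast
  have Xl: "X ^ l = monom 1 l" by (simp add: X_def monom_power)
  have pc: "pCons a g = [:a:] + X * g" by (simp add: X_def monom_altdef)
  have ca: "[:a:] ^ l - [:a:] = of_nat l * [:c:]"
    using c by (simp add: of_nat_poly poly_const_pow)
  have "pCons a g ^ l - pcompose (pCons a g) (monom 1 l)
      = ([:a:] ^ l - [:a:]) + monom 1 l * (g ^ l - pcompose g (monom 1 l)) + of_nat l * S"
    unfolding pcompose_pCons unfolding pc binomial_prime_power[OF l(1), of "[:a:]" "X * g"] S_def
    by (simp add: power_mult_distrib Xl algebra_simps)
  also have "\<dots> = of_nat l * ([:c:] + monom 1 l * h + S)"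
    unfolding ca h by (simp add: algebra_simps)
  finally show ?case by simp
qed

text \<open>The difference of the two sides is \<open>l\<close> times a cyclotomic integer whose conjugates have
    absolute
  value at most \<open>2 / l < 1\<close>.\<close>

lemma kronecker_prime_power:
  assumes d: "d > 0" and g: "\<And>v. v \<in> prim d \<Longrightarrow> cmod (ev g v) = 1"
    and l: "prime l" "odd l" "coprime l d" and v: "v \<in> prim d"
  shows "ev g (v ^ l) = ev g v ^ l"
proof -
  obtain h where h: "g ^ l - pcompose g (monom 1 l) = of_nat l * h"
    using frobenius_poly[OF l(1,2)] by blast
  have eq: "ev g v ^ l - ev g (v ^ l) = of_nat l * ev h v" for v
    using arg_cong[OF h, of "\<lambda>f. ev f v"]
        by (simp add: hom_distribs poly_pcompose poly_monom of_int_hom.map_poly_pcompose)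
  have l3: "l \<ge> 3" using l prime_ge_2_nat[of l] by (cases "l = 2") auto
  have "cmod (ev h v) < 1" if v: "v \<in> prim d" for v
  proof -
    have "real l * cmod (ev h v) = cmod (ev g v ^ l - ev g (v ^ l))"
      unfolding eq by (simp add: norm_mult)
    also have "\<dots> \<le> cmod (ev g v ^ l) + cmod (ev g (v ^ l))" by (rule norm_triangle_ineq4)
    also have "\<dots> = 2" using g[OF v] g[OF prim_power[OF v l(3)]] by (simp add: norm_power)
    also have "\<dots> < real l * 1" using l3 by simp
    finally have "real l * cmod (ev h v) < real l * 1" .
    then show ?thesis using l3 by simp
  qed
  then have "ev h v = 0" using ev_small_prim_eq_0[OF d _ v] by blast
  then show ?thesis using eq[of v] by simp
qed

text \<open>Peels off one prime factor \<open>l\<close> of \<open>k\<close> at a time;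
  \<open>v ^ l\<close> is again primitive, so the induction hypothesis applies to it.\<close>

lemma kronecker_coprime_power:
  assumes d: "d > 0" and g: "\<And>v. v \<in> prim d \<Longrightarrow> cmod (ev g v) = 1"
  shows "odd k \<Longrightarrow> coprime k d \<Longrightarrow> v \<in> prim d \<Longrightarrow> ev g (v ^ k) = ev g v ^ k"
proof (induction k arbitrary: v rule: less_induct)
  case (less k)
  show ?case
  proof (cases "k = 1")
    case False
    then obtain l where l: "prime l" "l dvd k" using prime_factor_nat by blast
    then obtain m where m: "k = l * m" by blast
    have cop: "odd l" "odd m" "coprime l d" "coprime m d" using less.prems m by auto
    have "1 * m < l * m"
      using cop(2) prime_gt_1_nat[OF l(1)] by (intro mult_strict_right_mono) (auto intro!: Nat.gr0I)
    then have "m < k" by (simp add: m)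
    have "ev g (v ^ k) = ev g ((v ^ l) ^ m)" by (simp add: m power_mult)
    also have "\<dots> = ev g (v ^ l) ^ m"
      using less.IH[OF \<open>m < k\<close> cop(2,4)] prim_power[OF less.prems(3) cop(3)] by blast
    also have "\<dots> = ev g v ^ k"
      using kronecker_prime_power[OF d g l(1) cop(1,3) less.prems(3)] by (simp add: m power_mult)
    finally show ?thesis .
  qed simp
qed

text \<open>The exponent \<open>2 * d + 1\<close> is odd, prime to \<open>d\<close> and congruent to
  1 modulo \<open>d\<close>, so \<open>g(v)\<close> equals its own power with that exponent and is a
  \<open>2d\<close>-th root of unity.\<close>

lemma kronecker:
  assumes d: "odd d" and g: "\<And>v. v \<in> prim d \<Longrightarrow> cmod (ev g v) = 1" and v: "v \<in> prim d"
  obtains e c where "e \<in> {1, -1}" "ev g v = e * v ^ c"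
proof -
  have d0: "d > 0" using d by (intro Nat.gr0I) auto
  have "coprime (2 * d + 1) d" by
      (metis coprime_add_one_left coprime_commute coprime_mult_right_iff)
  then have "ev g (v ^ (2 * d + 1)) = ev g v ^ (2 * d + 1)"
    using kronecker_coprime_power[OF d0 g _ _ v, of "2 * d + 1"] by simp
  moreover have "v ^ (2 * d + 1) = v"
    using prim_power_self[OF v] by (simp add: power_add mult.commute power_mult)
  ultimately have "ev g v = ev g v ^ (2 * d + 1)" by (simp only:)
  then have "ev g v * ev g v ^ (2 * d) = ev g v * 1" by simp
  moreover have "ev g v \<noteq> 0" using g[OF v] by auto
  ultimately have "ev g v ^ (2 * d) = 1" by simp
  then have "(ev g v ^ d)\<^sup>2 = 1" by (simp add: mult.commute flip: power_mult)
  then have e: "ev g v ^ d \<in> {1, -1}" by (simp add: power2_eq_1_iff)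
  \<comment> \<open>The sign \<open>e\<close> satisfies \<open>e ^ d = e\<close> for odd
    \<open>d\<close>, so \<open>e * g(v)\<close> is a \<open>d\<close>-th root of unity, that is, a
    power of \<open>v\<close>.\<close>
  define e where "e = ev g v ^ d"
  have ee: "e * e = 1" "e ^ d = e" using e d unfolding e_def[symmetric] by auto
  have "(e * ev g v) ^ d = 1" using ee by (simp add: power_mult_distrib flip: e_def)
  then have "e * ev g v \<in> (\<lambda>k. v ^ k) ` {0<..d}"
    using prim_powers[OF d0 v] by (auto simp: bij_betw_def)
  then obtain c where "e * ev g v = v ^ c" by auto
  then have "ev g v = e * v ^ c" using ee(1) by (metis mult.assoc mult_1)
  then show ?thesis using e that unfolding e_def[symmetric] by blast
qed

text \<open>As the norm \<open>N\<close> is a sign, \<open>N / F(cnj v)\<close> is the product of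
  the other conjugates, so \<open>F(v) / F(cnj v)\<close> is up to that sign an integer polynomial
  in \<open>v\<close>. Its modulus is 1 at all primitive roots, and Kronecker's theorem
  applies.\<close>

lemma unit_eq_root_times_cnj:
  assumes d: "odd d" and N: "(\<Prod>v\<in>prim d. ev F v) \<in> {1, -1}" and z: "z \<in> prim d"
  obtains e c where "e \<in> {1, -1}" "ev F z = e * z ^ c * ev F (cnj z)"
proof -
  have d0: "d > 0" using d by (intro Nat.gr0I) auto
  define N where "N = (\<Prod>v\<in>prim d. ev F v)"
  have NN: "N \<in> {1, -1}" using N by (simp add: N_def)
  \<comment> \<open>The exponent \<open>(d - 1) * k\<close> turns \<open>v\<close> into
    \<open>cnj v ^ k\<close>; leaving out \<open>k = 1\<close> drops the factor
    \<open>F(cnj v)\<close>.\<close>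
  define g where "g = F * (\<Prod>k\<in>totatives d - {1}. pcompose F (monom 1 ((d - 1) * k)))"
  have g: "ev g v * ev F (cnj v) = ev F v * N" if v: "v \<in> prim d" for v
  proof -
    have "N = (\<Prod>k\<in>totatives d. ev F (cnj v ^ k))"
      unfolding N_def by (rule prod.reindex_bij_betw[OF prim_totatives[OF d0 prim_cnj[OF v]],
          symmetric])
    also have "\<dots> = ev F (cnj v) * (\<Prod>k\<in>totatives d - {1}. ev F (cnj v ^ k))"
      using d0 by (subst prod.remove[of _ 1]) auto
    also have "(\<Prod>k\<in>totatives d - {1}. ev F (cnj v ^ k))
        = (\<Prod>k\<in>totatives d - {1}. ev (pcompose F (monom 1 ((d - 1) * k))) v)"
      using root_cnj(3)[OF d0 prim_power_self[OF v]]
      by (intro prod.cong refl) (simp add: ev_pcompose poly_monom power_mult)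
    finally show ?thesis by (simp add: g_def of_int_poly_hom.hom_mult of_int_poly_hom.hom_prod
        poly_prod mult_ac)
  qed
  have nz: "ev F v \<noteq> 0" if "v \<in> prim d" for v
  proof
    assume "ev F v = 0"
    then have "N = 0" unfolding N_def using that d0 by (intro prod_zero) auto
    then show False using NN by simp
  qed
  have "cmod (ev g v) = 1" if v: "v \<in> prim d" for v
  proof -
    have "cmod (ev g v) * cmod (ev F v) = 1 * cmod (ev F v)"
      using arg_cong[OF g[OF v], of cmod] NN by (auto simp: norm_mult ev_cnj)
    then show ?thesis using nz[OF v] by simp
  qed
  then obtain e c where e: "e \<in> {1, -1}" "ev g z = e * z ^ c" using kronecker[OF d _ z] by blast
  have "ev F z = (N * e) * z ^ c * ev F (cnj z)" using g[OF z] NN e by auto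
  moreover have "N * e \<in> {1, -1}" using NN e(1) by auto
  ultimately show ?thesis using that by blast
qed

section \<open>Norms at primitive roots of unity\<close>

text \<open>For \<open>d > 0\<close> this is the norm from the \<open>d\<close>-th cyclotomic field,
  kept complex-valued because integrality is proved separately in
  \<open>prim_norm_is_int\<close>.\<close>

definition prim_norm :: "nat \<Rightarrow> int poly \<Rightarrow> complex" where
  "prim_norm d F = (\<Prod>v\<in>prim d. ev F v)"

lemma prim_1 [simp]: "prim 1 = {1}" "prim (Suc 0) = {1}"
proof -
  have "z = 1" if "z \<in> prim 1" for z using prim_power_self[OF that] by simp
  then show "prim 1 = {1}" by (auto simp: prim_def)
  then show "prim (Suc 0) = {1}" by simp
qed

lemma ev_1: "ev F 1 = of_int (poly F 1)"
  by (metis of_int_hom.poly_map_poly of_int_1)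

lemma ev_const [simp]: "ev [:a:] v = of_int a"
  by (cases "a = 0") auto

lemma prim_norm_1 [simp]: "prim_norm 1 F = of_int (poly F 1)" "prim_norm (Suc 0) F
    = of_int (poly F 1)"
  by (simp_all only: prim_norm_def prim_1 ev_1) (simp_all add: ev_1)

lemma prim_norm_cyc: "d > 0 \<Longrightarrow> prim_norm d F \<in> cyc"
  unfolding prim_norm_def by (intro cyc_prod cyc_ev prim_cyc)

lemma prim_norm_factor:
  assumes "d > 0" "y \<in> prim d"
  obtains r where "r \<in> cyc" "ev F y * r = prim_norm d F"
proof
  show "(\<Prod>v\<in>prim d - {y}. ev F v) \<in> cyc" using assms by (intro cyc_prod cyc_ev prim_cyc) auto
  show "ev F y * (\<Prod>v\<in>prim d - {y}. ev F v) = prim_norm d F"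
    unfolding prim_norm_def using assms by (subst prod.remove[of "prim d" y]) auto
qed

lemma prod_roots_eq_prod_prim_norm:
  "n > 0 \<Longrightarrow> (\<Prod>z\<in>{z. z ^ n = 1}. ev F z) = (\<Prod>d\<in>{d. d dvd n}. prim_norm d F)"
  by (simp add: prod_roots_eq_prod_prim prim_norm_def)

text \<open>Strong induction: the product over all divisors of \<open>d\<close> is the integer
  \<open>poly H 1\<close>, and dividing by the nonzero earlier norms leaves a rational algebraic
  integer.\<close>

lemma prim_norm_is_int:
  assumes n: "n > 0" and nz: "(\<Prod>z\<in>{z. z ^ n = 1}. ev F z) \<noteq> 0"
  shows "d dvd n \<Longrightarrow> prim_norm d F \<in> \<int>"
proof (induction d rule: less_induct)
  case (less d)
  have d: "d > 0" using less.prems n by (intro Nat.gr0I) auto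
  obtain H where H: "\<And>w. w \<noteq> 0 \<Longrightarrow> ev H w = (\<Prod>v\<in>{v. v ^ d = w}. ev F v)"
    using norm_poly_exists[OF d] by blast
  have nz': "prim_norm e F \<noteq> 0" if "e dvd n" for e
    using nz n that by (simp add: prod_roots_eq_prod_prim_norm)
  define R where "R = (\<Prod>e\<in>{e. e dvd d} - {d}. prim_norm e F)"
  have "R \<in> \<int>" unfolding R_def
  proof (rule Ints_prod)
    fix e assume e: "e \<in> {e. e dvd d} - {d}"
    then have "e < d" using d by (auto dest!: dvd_imp_le)
    then show "prim_norm e F \<in> \<int>" using less.IH e less.prems dvd_trans by blast
  qed
  then obtain b where b: "R = of_int b" by (auto elim: Ints_cases)
  have "R \<noteq> 0" unfolding R_def using nz' d less.prems dvd_trans by (auto simp: prod_zero_iff)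
  have "of_int (poly H 1) = (\<Prod>e\<in>{e. e dvd d}. prim_norm e F)"
    using H[of 1] d by (simp add: ev_1 prod_roots_eq_prod_prim_norm)
  also have "\<dots> = prim_norm d F * R"
    unfolding R_def using d by (subst prod.remove[of _ d]) auto
  finally have "prim_norm d F = of_int (poly H 1) / of_int b"
      using \<open>R \<noteq> 0\<close> b by (simp add: field_simps)
  then have "prim_norm d F \<in> \<rat>" by simp
  then show ?case using cyc_rational_is_int prim_norm_cyc[OF d] by blast
qed

text \<open>Each root of order \<open>p ^ j * m\<close> is \<open>y * x\<close> with
  \<open>y\<close> of order \<open>p ^ j\<close>, and \<open>y\<close> is 1 modulo the radical of
  \<open>p\<close>.\<close>

lemma prim_norm_cong:
  assumes p: "prime p" "odd p" and m: "m > 0" "coprime p m"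
  shows "prim_norm (p ^ j * m) F - prim_norm m F ^ card (prim (p ^ j)) \<in> rad p"
proof -
  have p0: "p ^ j > 0" using p prime_gt_0_nat by simp
  have 1: "prim_norm (p ^ j * m) F = (\<Prod>y\<in>prim (p ^ j). \<Prod>x\<in>prim m. ev F (y * x))"
    unfolding prim_norm_def by (rule prod_prim_mult) (use m in simp)
  have 2: "prim_norm m F ^ card (prim (p ^ j)) = (\<Prod>y\<in>prim (p ^ j). \<Prod>x\<in>prim m. ev F x)"
    by (simp add: prim_norm_def)
  have "ev F (y * x) - ev F x \<in> rad p" if "y \<in> prim (p ^ j)" "x \<in> prim m" for x y
  proof (rule rad_cong_ev)
    have "y - 1 \<in> rad p" using rad_root_minus_1[OF p] prim_power_self[OF that(1)] by blast
    then have "(y - 1) * x \<in> rad p" using prim_cyc[OF m(1) that(2)] by (rule rad_mult)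
    then show "y * x - x \<in> rad p" by (simp add: left_diff_distrib)
  qed (use that prim_cyc m(1) p0 in blast)+
  then have "(\<Prod>y\<in>prim (p ^ j). \<Prod>x\<in>prim m. ev F (y * x)) - (\<Prod>y\<in>prim (p ^ j). \<Prod>x\<in>prim m. ev F x)
      \<in> rad p"
    using prim_cyc[OF p0] prim_cyc[OF m(1)] by (intro rad_cong_prod cyc_prod cyc_ev cyc_mult) auto
  then show ?thesis by (simp only: 1 2)
qed

lemma prim_norm_dvd_iff:
  assumes p: "prime p" "odd p" and m: "m > 0" "coprime p m"
    and a: "prim_norm (p ^ j * m) F = of_int a" and b: "prim_norm m F = of_int b"
  shows "int p dvd a \<longleftrightarrow> int p dvd b"
proof -
  have p0: "p ^ j > 0" using p prime_gt_0_nat by simp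
  \<comment> \<open>A primitive root exists, so the exponent \<open>card (prim (p ^ j))\<close> is
    positive, as is required for \<open>p\<close> to divide \<open>b\<close> whenever it divides
    \<open>b\<close> to that power and conversely.\<close>
  have "cis (2 * pi / real (p ^ j)) \<in> prim (p ^ j)" by (rule cis_in_prim[OF p0])
  then have c: "card (prim (p ^ j)) > 0" using finite_prim[OF p0] by (auto simp: card_gt_0_iff)
  have "of_int (a - b ^ card (prim (p ^ j))) \<in> rad p"
    using prim_norm_cong[OF p m, of j F] a b by simp
  then have "int p dvd a - b ^ card (prim (p ^ j))" using rad_of_int_iff[OF p(1)] by blast
  then have "int p dvd a \<longleftrightarrow> int p dvd b ^ card (prim (p ^ j))"
      by (metis dvd_diff_commute zdvd_zdiffD dvd_diff_left_iff)
  also have "\<dots> \<longleftrightarrow> int p dvd b" using p c by (simp add: prime_dvd_power_iff)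
  finally show ?thesis .
qed

text \<open>Modulo the radical of \<open>p\<close> both \<open>y\<close> and \<open>cnj y\<close>
  become 1; the sign -1 would put \<open>2 * F(1)\<close> into the radical.\<close>

lemma sign_pos_at_prime:
  assumes p: "prime p" "odd p" and y: "y \<in> prim p"
    and e: "e \<in> {1, -1}" "ev F y = e * y ^ c * ev F (cnj y)" and F1: "\<not> int p dvd poly F 1"
  shows "e = 1"
proof (rule ccontr)
  assume "e \<noteq> 1"
  then have e: "ev F y = - (y ^ c * ev F (cnj y))" using e by simp
  have p0: "p > 0" using p prime_gt_0_nat by simp
  have yc: "y \<in> cyc" "cnj y \<in> cyc" using prim_cyc[OF p0] y prim_cnj by auto
  have r: "v - 1 \<in> rad p" if "v \<in> prim p" for v
    using rad_root_minus_1[OF p, of v 1] prim_power_self[OF that] by simp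
  have 1: "ev F y - ev F 1 \<in> rad p" "ev F (cnj y) - ev F 1 \<in> rad p"
    by (rule rad_cong_ev; use r[OF y] r[OF prim_cnj[OF y]] yc in simp)+
  have 2: "y ^ c - 1 ^ c \<in> rad p" using r[OF y] yc by (intro rad_cong_power) auto
  have "y ^ c * ev F (cnj y) - 1 ^ c * ev F 1 \<in> rad p"
    using 1 2 yc by (intro rad_cong_mult) auto
  then have "- (ev F y - ev F 1) - (y ^ c * ev F (cnj y) - 1 ^ c * ev F 1) \<in> rad p"
    by (rule rad_diff[OF rad_uminus[OF 1(1)]])
  then have "of_int (2 * poly F 1) \<in> rad p" unfolding e by (simp add: ev_1)
  then have "int p dvd 2 * poly F 1" using rad_of_int_iff[OF p(1)] by blast
  moreover have "\<not> int p dvd 2" using p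
      by (metis int_dvd_int_iff of_nat_numeral primes_dvd_imp_eq two_is_prime_nat even_numeral)
  ultimately show False using F1 p(1) by (simp add: prime_dvd_mult_iff)
qed

lemma unit_at_prime:
  assumes p: "prime p" "odd p" and N: "prim_norm p F \<in> {1, -1}" and y: "y \<in> prim p"
  obtains c where "ev F y = y ^ c * ev F (cnj y)"
proof -
  obtain e c where ec: "e \<in> {1, -1}" "ev F y = e * y ^ c * ev F (cnj y)"
    using unit_eq_root_times_cnj[OF p(2) _ y] N unfolding prim_norm_def by blast
  obtain a :: int where a: "prim_norm p F = of_int a" "a \<in> {1, -1}"
    using N by (metis insert_iff of_int_1 of_int_minus singletonD)
  have "\<not> int p dvd a" using a(2) p by (auto simp: not_prime_unit)
  then have "\<not> int p dvd poly F 1"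
    using prim_norm_dvd_iff[OF p, of 1 1 F a "poly F 1"] a by simp
  then have "e = 1" using sign_pos_at_prime[OF p y ec] by blast
  then have "ev F y = y ^ c * ev F (cnj y)" using ec(2) by simp
  then show ?thesis by (rule that)
qed

section \<open>The cyclotomic polynomial of prime index and values of norm p\<close>

lemma prod_linear_factors_dvd:
  fixes f :: "'a::idom poly"
  assumes "finite S"
  shows "(\<And>a. a \<in> S \<Longrightarrow> poly f a = 0) \<Longrightarrow> (\<Prod>a\<in>S. [:-a, 1:]) dvd f"
  using assms
proof (induction S arbitrary: f rule: finite_induct)
  case (insert a S)
  obtain g where g: "f = [:-a, 1:] * g" using insert.prems[of a] by (auto simp: poly_eq_0_iff_dvd)
  have "poly g b = 0" if "b \<in> S" for b
    using insert.prems[of b] that insert.hyps(2) by (auto simp: g)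
  then have "(\<Prod>a\<in>S. [:-a, 1:]) dvd g" by (rule insert.IH)
  then show ?case unfolding g using insert.hyps
      by (subst prod.insert) (auto intro!: mult_dvd_mono simp del: mult_pCons_left)
qed simp

lemma poly_1_remainder:
  obtains G where "F = [:poly F (1::int):] + [:-1, 1:] * G"
proof -
  have "[:-1, 1:] dvd F - [:poly F 1:]" by (simp flip: poly_eq_0_iff_dvd)
  then obtain G where "F - [:poly F 1:] = [:-1, 1:] * G" by blast
  then have "F = [:poly F 1:] + [:-1, 1:] * G" by (metis add.commute diff_add_cancel)
  then show ?thesis by (rule that)
qed

text \<open>For prime \<open>p\<close> this is the \<open>p\<close>-th cyclotomic polynomial; in
  general it is \<open>(x^p - 1) / (x - 1)\<close>.\<close>

definition cyclo :: "nat \<Rightarrow> int poly" where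
  "cyclo p = (\<Sum>i<p. monom 1 i)"

lemma coeff_cyclo: "coeff (cyclo p) i = (if i < p then 1 else 0)"
  by (simp add: cyclo_def coeff_sum)

lemma poly_cyclo_1: "poly (cyclo p) 1 = int p"
  by (simp add: cyclo_def poly_sum poly_monom)

lemma ev_cyclo: "ev (cyclo p) v = (\<Sum>i<p. v ^ i)"
  by (simp add: cyclo_def of_int_poly_hom.hom_sum poly_sum poly_monom)

lemma ev_cyclo_prim: 
  assumes "p > 1" "v \<in> prim p"
  shows "ev (cyclo p) v = 0"
proof -
  have "v \<noteq> 1" using assms prim_power_eq_1_iff[OF assms(2), of 1] by auto
  then show ?thesis using prim_power_self[OF assms(2)] geometric_sum[of v p] by (simp add: ev_cyclo)
qed

text \<open>Counting degrees, the monic polynomial \<open>cyclo p\<close> is the product of the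
  factors \<open>x - v\<close>; evaluate at 1.\<close>

lemma prod_one_minus_prim:
  assumes p: "prime p"
  shows "(\<Prod>v\<in>prim p. 1 - v) = of_nat p"
proof -
  have p1: "p > 1" using p prime_gt_1_nat by blast
  define f where "f = (of_int_poly (cyclo p) :: complex poly)"
  define Q where "Q = (\<Prod>v\<in>prim p. [:-v, 1:])"
  have cf: "coeff f i = (if i < p then 1 else 0)" for i by (simp add: f_def coeff_cyclo)
  have "degree f = p - 1"
  proof (rule antisym)
    show "degree f \<le> p - 1" by (rule degree_le) (auto simp: cf)
    show "p - 1 \<le> degree f" by (rule le_degree) (use p1 in \<open>simp add: cf\<close>)
  qed
  have "bij_betw (\<lambda>k. cis (2 * pi / p) ^ k) (totatives p) (prim p)"
    using p1 by (intro prim_totatives cis_in_prim) auto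
  then have "card (prim p) = card (totatives p)" by (rule bij_betw_same_card[symmetric])
  then have card: "card (prim p) = p - 1" using p by (simp add: totatives_prime)
  have degQ: "degree Q = p - 1"
    unfolding Q_def by (subst degree_prod_sum_eq) (auto simp: card)
  have "Q dvd f"
    unfolding Q_def using p1 ev_cyclo_prim by (intro prod_linear_factors_dvd) (auto simp: f_def)
  then obtain g where g: "f = Q * g" by blast
  have "f \<noteq> 0" using cf[of 0] p1 by auto
  then have "Q \<noteq> 0" "g \<noteq> 0" using g by auto
  then have "degree g = 0" using g \<open>degree f = p - 1\<close> degQ by (simp add: degree_mult_eq)
  then obtain c where c: "g = [:c:]" using degree_eq_zeroE by blast
  have fQ: "f = smult c Q" using g c by simp
  have "lead_coeff Q = 1" unfolding Q_def by (simp add: lead_coeff_prod)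
  then have "coeff f (p - 1) = c" unfolding fQ by (simp add: degQ)
  then have "c = 1" using p1 by (simp add: cf)
  then have "f = Q" using fQ by simp
  have "poly f 1 = (\<Prod>v\<in>prim p. 1 - v)" unfolding \<open>f = Q\<close> by (simp add: Q_def poly_prod)
  then show ?thesis by (simp add: f_def ev_1 poly_cyclo_1)
qed

lemma norm_p_at_prime:
  assumes p: "prime p" "odd p" and N: "prim_norm p F \<in> {of_nat p, - of_nat p}" and y: "y \<in> prim p"
  obtains c where "ev F y = - (y ^ c * ev F (cnj y))"
proof -
  have p1: "p > 1" using p prime_gt_1_nat by blast
  obtain a :: int where a: "prim_norm p F = of_int a" "a \<in> {int p, - int p}"
    using N by (metis insert_iff of_int_minus of_int_of_nat_eq singletonD)
  then have "int p dvd a" by auto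
  then have "int p dvd poly F 1"
    using prim_norm_dvd_iff[OF p, of 1 1 F a "poly F 1"] a by simp
  then obtain c0 where c0: "poly F 1 = int p * c0" by blast
  obtain G where G: "F = [:poly F 1:] + [:-1, 1:] * G" by (rule poly_1_remainder)
  obtain D where D: "cyclo p = [:poly (cyclo p) 1:] + [:-1, 1:] * D" by (rule poly_1_remainder)
  \<comment> \<open>In \<open>F = F(1) + (x - 1) * G\<close> with \<open>F(1) = p * c0\<close>, the
    relation \<open>p = (1 - v) * D(v)\<close> at primitive \<open>v\<close> lets
    \<open>1 - v\<close> be taken out of both terms; \<open>U\<close> gives the quotient.\<close>
  define U where "U = [:c0:] * D - G"
  have U: "ev F v = (1 - v) * ev U v" if v: "v \<in> prim p" for v
  proof -
    have F: "ev F v = of_nat p * of_int c0 + (v - 1) * ev G v"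
      using arg_cong[OF G, of "\<lambda>f. ev f v"]
      unfolding of_int_poly_hom.hom_add of_int_poly_hom.hom_mult poly_add poly_mult
      by (simp add: c0 algebra_simps)
    have "ev (cyclo p) v = of_nat p + (v - 1) * ev D v"
      using arg_cong[OF D, of "\<lambda>f. ev f v"]
      unfolding of_int_poly_hom.hom_add of_int_poly_hom.hom_mult poly_add poly_mult
      by (simp add: poly_cyclo_1 algebra_simps)
    then have P: "of_nat p = (1 - v) * ev D v"
        using ev_cyclo_prim[OF p1 v] by (simp add: algebra_simps)
    have Uv: "ev U v = of_int c0 * ev D v - ev G v"
      unfolding U_def of_int_poly_hom.hom_minus of_int_poly_hom.hom_mult poly_diff poly_mult by simp
    show ?thesis unfolding F P Uv by (simp add: algebra_simps)
  qed
  have "prim_norm p F = (\<Prod>v\<in>prim p. 1 - v) * prim_norm p U"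
    by (simp add: prim_norm_def U prod.distrib)
  then have "of_nat p * prim_norm p U \<in> {of_nat p * 1, of_nat p * (-1)}"
    using N prod_one_minus_prim[OF p(1)] by simp
  then have "prim_norm p U \<in> {1, -1}"
    using p1 by (simp only: insert_iff empty_iff mult_cancel_left of_nat_eq_0_iff) simp
  then obtain c where c: "ev U y = y ^ c * ev U (cnj y)" using unit_at_prime[OF p _ y] by blast
  have yc: "y * cnj y = 1" using root_cnj(2)[of p] p1 prim_power_self[OF y] by auto
  have "ev F y = (1 - y) * (y ^ c * ev U (cnj y))" using U[OF y] c by simp
  also have "1 - y = - (y * (1 - cnj y))" using yc by (simp add: right_diff_distrib)
  also have "- (y * (1 - cnj y)) * (y ^ c * ev U (cnj y))
      = - (y ^ Suc c * ((1 - cnj y) * ev U (cnj y)))"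
    by simp
  also have "(1 - cnj y) * ev U (cnj y) = ev F (cnj y)" using U[OF prim_cnj[OF y]] by simp
  finally show ?thesis by (rule that)
qed

section \<open>The values of the norms are contradictory\<close>

lemma rad_prim_minus_1:
  assumes "prime p" "odd p" "y \<in> prim p"
  shows "y - 1 \<in> rad p"
  using rad_root_minus_1[OF assms(1,2), of y 1] prim_power_self[OF assms(3)] by simp

lemma prim_power_bij:
  assumes "coprime k d"
  shows "bij_betw (\<lambda>y. y ^ k) (prim d) (prim d)"
proof -
  obtain t where t: "[k * t = Suc 0] (mod d)" using cong_solve_coprime_nat[OF assms] by blast
  then have ct: "coprime t d"
    using cong_imp_coprime[OF cong_sym[OF t]] by (simp add: coprime_mult_left_iff)
  have inv: "y ^ (k * t) = y" if "y \<in> prim d" for y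
    using root_power_cong[OF t prim_power_self[OF that]] by simp
  show ?thesis
    by (rule bij_betwI[where g = "\<lambda>y. y ^ t"])
      (use prim_power assms ct inv in \<open>auto simp: mult.commute simp flip: power_mult\<close>)
qed

lemma ev_norm_poly_power:
  assumes H: "\<And>w. w \<noteq> 0 \<Longrightarrow> ev H w = (\<Prod>v\<in>{v. v ^ k = w}. ev F v)" and y: "y \<noteq> 0"
  shows "ev H (y ^ k) = (\<Prod>x\<in>{x. x ^ k = 1}. ev F (x * y))"
proof -
  have "bij_betw (\<lambda>x. x * y) {x. x ^ k = 1} {v. v ^ k = y ^ k}"
    by (rule bij_betwI[where g = "\<lambda>v. v / y"]) (use y in \<open>auto simp: power_mult_distrib
        power_divide\<close>)
  from prod.reindex_bij_betw[OF this, of "ev F"] show ?thesis using H[of "y ^ k"] y by simp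
qed

lemma prim_nonzero: "d > 0 \<Longrightarrow> y \<in> prim d \<Longrightarrow> y \<noteq> 0"
  using prim_power_self[of y d] by (auto simp: power_0_left)

lemma pm_int_coprime:
  assumes "x \<in> {of_int b, - of_int b :: complex}" "coprime b c"
  obtains a where "x = of_int a" "coprime a c"
  using assms that[of b] that[of "- b"] by auto

text \<open>Excludes \<open>m = q\<close>. The norm \<open>H\<close> of \<open>F\<close> along
  \<open>z -> z^q\<close> has norm \<open>p\<close> up to sign, hence sign -1 at
  \<open>y ^ q\<close>, while \<open>F\<close> has sign 1 at \<open>y\<close>; but
  \<open>H(y^q)\<close> and \<open>F(y)^q\<close> agree modulo the radical of
  \<open>q\<close>.\<close>

lemma not_unit_at_p_norm_p_at_pq:
  assumes p: "prime p" "odd p" and q: "prime q" "odd q" and pq: "p \<noteq> q"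
    and 1: "prim_norm p F \<in> {1, -1}" and 2: "prim_norm (p * q) F \<in> {of_nat p, - of_nat p}"
  shows False
proof -
  have p0: "p > 0" and q0: "q > 0" using p q prime_gt_0_nat by auto
  have cop: "coprime p q" using p q pq by (simp add: primes_coprime)
  obtain H where H: "\<And>w. w \<noteq> 0 \<Longrightarrow> ev H w = (\<Prod>v\<in>{v. v ^ q = w}. ev F v)"
    using norm_poly_exists[OF q0] by blast
  have Hy: "ev H (y ^ q) = (\<Prod>x\<in>{x. x ^ q = 1}. ev F (x * y))" if "y \<in> prim p" for y
    using ev_norm_poly_power[OF H prim_nonzero[OF p0 that]] .
  have div: "{d. d dvd q} = {1, q}" using q(1) by (auto simp: prime_nat_iff)
  have "prim_norm p H = (\<Prod>y\<in>prim p. ev H (y ^ q))"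
    unfolding prim_norm_def
    by (rule prod.reindex_bij_betw[OF prim_power_bij, symmetric]) (use cop in \<open>simp add:
        coprime_commute\<close>)
  also have "\<dots> = (\<Prod>y\<in>prim p. ev F y * (\<Prod>x\<in>prim q. ev F (y * x)))"
  proof (intro prod.cong refl)
    fix y assume y: "y \<in> prim p"
    have "ev H (y ^ q) = (\<Prod>d\<in>{1, q}. \<Prod>x\<in>prim d. ev F (x * y))"
      using Hy[OF y] prod_roots_eq_prod_prim[OF q0, of "\<lambda>x. ev F (x * y)"] div by simp
    also have "\<dots> = ev F y * (\<Prod>x\<in>prim q. ev F (y * x))"
      using prime_gt_1_nat[OF q(1)] by (simp add: mult.commute)
    finally show "ev H (y ^ q) = ev F y * (\<Prod>x\<in>prim q. ev F (y * x))" .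
  qed
  also have "\<dots> = prim_norm p F * prim_norm (p * q) F"
    by (simp add: prod.distrib prim_norm_def prod_prim_mult[OF cop])
  finally have NH: "prim_norm p H \<in> {of_nat p, - of_nat p}" using 1 2 by auto
  obtain y where y: "y \<in> prim p" using cis_in_prim[OF p0] by blast
  have yc: "y \<in> cyc" "cnj y \<in> cyc" using y prim_cnj prim_cyc[OF p0] by auto
  have y': "y ^ q \<in> prim p" using prim_power[OF y] cop by (simp add: coprime_commute)
  obtain c where c: "ev H (y ^ q) = - ((y ^ q) ^ c * ev H (cnj y ^ q))"
    using norm_p_at_prime[OF p NH y'] by (metis complex_cnj_power)
  obtain c' where c': "ev F y = y ^ c' * ev F (cnj y)" using unit_at_prime[OF p 1 y] by blast
  have HF: "ev H (v ^ q) - ev F v ^ q \<in> rad q" if v: "v \<in> prim p" for v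
  proof -
    have vc: "v \<in> cyc" using v prim_cyc[OF p0] by blast
    have "ev F (x * v) - ev F v \<in> rad q" if x: "x ^ q = 1" for x
    proof (rule rad_cong_ev)
      have "(x - 1) * v \<in> rad q" using rad_root_minus_1[OF q, of x 1] x vc by (intro rad_mult) auto
      then show "x * v - v \<in> rad q" by (simp add: left_diff_distrib)
    qed (use vc cyc_root[OF q0 x] in auto)
    then have "(\<Prod>x\<in>{x. x ^ q = 1}. ev F (x * v)) - (\<Prod>x\<in>{x::complex. x ^ q = 1}. ev F v) \<in> rad q"
      using vc cyc_root[OF q0] by (intro rad_cong_prod cyc_ev cyc_mult) auto
    then show ?thesis using Hy[OF v] card_power_eq[OF q0, of 1] by simp
  qed
  \<comment> \<open>By \<open>c\<close> the values of \<open>H\<close> cancel in this combination;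
    \<open>c'\<close> then leaves a sum of two powers of \<open>y\<close> times
    \<open>F(cnj y)^q\<close>, a divisor of 1 or -1.\<close>
  have "(ev H (y ^ q) - ev F y ^ q) + (y ^ q) ^ c * (ev H (cnj y ^ q) - ev F (cnj y) ^ q) \<in> rad q"
    using HF[OF y] HF[OF prim_cnj[OF y]] yc by (intro rad_add rad_mult') auto
  then have "- ((ev H (y ^ q) - ev F y ^ q) + (y ^ q) ^ c * (ev H (cnj y ^ q) - ev F (cnj y) ^ q))
      \<in> rad q"
    by (rule rad_uminus)
  also have "- ((ev H (y ^ q) - ev F y ^ q) + (y ^ q) ^ c * (ev H (cnj y ^ q) - ev F (cnj y) ^ q))
     = (y ^ (c' * q) + y ^ (q * c)) * ev F (cnj y) ^ q"
    unfolding c c' by (simp add: algebra_simps power_mult_distrib flip: power_mult)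
  finally have *: "(y ^ (c' * q) + y ^ (q * c)) * ev F (cnj y) ^ q \<in> rad q" .
  obtain r where r: "r \<in> cyc" "ev F (cnj y) * r = prim_norm p F"
    using prim_norm_factor[OF p0 prim_cnj[OF y]] by blast
  have "ev F (cnj y) ^ q * r ^ q = prim_norm p F ^ q" using r(2) by (metis power_mult_distrib)
  also have "\<dots> = prim_norm p F" using 1 q(2) by auto
  finally obtain a where a: "ev F (cnj y) ^ q * r ^ q = of_int a" "coprime a (int q)"
    using pm_int_coprime[of "prim_norm p F" 1 "int q"] 1 by auto
  have "y ^ (c' * q) + y ^ (q * c) \<in> rad q"
    by (rule rad_cancel[OF * a(1) _ _ a(2)]) (use yc r in auto)
  then show False using sum_root_unity_not_in_rad[OF q p(2) prim_power_self[OF y]] by blast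
qed

text \<open>Excludes \<open>m = 1\<close>. The sign \<open>e\<close> at \<open>y * x\<close> is
  compared with the sign -1 at \<open>y\<close> modulo the radical of \<open>q\<close>, and with the
  sign 1 at \<open>x\<close> modulo that of \<open>p\<close>; the two demands are
  incompatible.\<close>

lemma not_norm_p_at_p_unit_at_pq:
  assumes p: "prime p" "odd p" and q: "prime q" "odd q" and pq: "p \<noteq> q"
    and 1: "prim_norm 1 F \<in> {of_nat p, - of_nat p}" and 2: "prim_norm p F \<in> {of_nat p, - of_nat p}"
    and 3: "prim_norm q F \<in> {1, -1}" and 4: "prim_norm (p * q) F \<in> {1, -1}"
  shows False
proof -
  have p0: "p > 0" and q0: "q > 0" using p q prime_gt_0_nat by auto
  have cop: "coprime p q" using p q pq by (simp add: primes_coprime)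
  obtain y where y: "y \<in> prim p" using cis_in_prim[OF p0] by blast
  obtain x where x: "x \<in> prim q" using cis_in_prim[OF q0] by blast
  have yc: "y \<in> cyc" "cnj y \<in> cyc" using y prim_cnj prim_cyc[OF p0] by auto
  have xc: "x \<in> cyc" "cnj x \<in> cyc" using x prim_cnj prim_cyc[OF q0] by auto
  have z: "y * x \<in> prim (p * q)" using prim_mult[OF cop y x] .
  obtain e c where e: "e \<in> {1, -1}" "ev F (y * x) = e * (y * x) ^ c * ev F (cnj (y * x))"
    using unit_eq_root_times_cnj[OF _ _ z] p(2) q(2) 4 unfolding prim_norm_def
        by (metis even_mult_iff)
  have ec: "e \<in> cyc" using e(1) cyc_uminus by auto
  \<comment> \<open>Sends the factor \<open>v\<close> of the root \<open>y * x\<close> to 1 and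
    keeps the factor \<open>u\<close>; it is applied with each of \<open>x\<close> and
    \<open>y\<close> in the role of \<open>v\<close>.\<close>
  have mod: "ev F u - e * u ^ c * ev F (cnj u) \<in> rad r"
    if "u * v = y * x" "u \<in> cyc" "cnj u \<in> cyc" "v \<in> cyc" "cnj v \<in> cyc" "v - 1 \<in> rad r" "cnj v - 1
        \<in> rad r" for u v r
  proof -
    have "u * v - u * 1 \<in> rad r" "cnj u * cnj v - cnj u * 1 \<in> rad r"
      using that rad_mult' by (metis right_diff_distrib)+
    then have A: "u * v - u \<in> rad r" "cnj u * cnj v - cnj u \<in> rad r" by simp_all
    have B: "ev F (u * v) - ev F u \<in> rad r" "ev F (cnj u * cnj v) - ev F (cnj u) \<in> rad r"
      by (rule rad_cong_ev; use A that in blast)+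
    have C: "(u * v) ^ c - u ^ c \<in> rad r" by (rule rad_cong_power; use A that in blast)
    have "e * ((u * v) ^ c * ev F (cnj u * cnj v) - u ^ c * ev F (cnj u)) \<in> rad r"
      using B C that ec by (intro rad_mult' rad_cong_mult) auto
    then have "e * ((u * v) ^ c * ev F (cnj u * cnj v) - u ^ c * ev F (cnj u))
        - (ev F (u * v) - ev F u) \<in> rad r"
      using B(1) by (rule rad_diff)
    moreover have "ev F (u * v) = e * (u * v) ^ c * ev F (cnj u * cnj v)"
      using e(2) that(1) by (metis complex_cnj_mult)
    ultimately show ?thesis by (simp add: algebra_simps)
  qed
  have rx: "x - 1 \<in> rad q" "cnj x - 1 \<in> rad q" using rad_prim_minus_1[OF q] x prim_cnj by auto
  have ry: "y - 1 \<in> rad p" "cnj y - 1 \<in> rad p" using rad_prim_minus_1[OF p] y prim_cnj by auto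
  have modq: "ev F y - e * y ^ c * ev F (cnj y) \<in> rad q"
    using mod[of y x q] yc xc rx by simp
  have modp: "ev F x - e * x ^ c * ev F (cnj x) \<in> rad p"
    using mod[of x y p] yc xc ry by (simp add: mult.commute)
  have "e = -1"
  proof (rule ccontr)
    assume "e \<noteq> -1"
    then have e1: "e = 1" using e(1) by simp
    obtain b where b: "ev F y = - (y ^ b * ev F (cnj y))" using norm_p_at_prime[OF p 2 y] by blast
    have "- (ev F y - e * y ^ c * ev F (cnj y)) \<in> rad q" using modq by (rule rad_uminus)
    also have "- (ev F y - e * y ^ c * ev F (cnj y)) = (y ^ b + y ^ c) * ev F (cnj y)"
      unfolding e1 b by (simp add: algebra_simps)
    finally have *: "(y ^ b + y ^ c) * ev F (cnj y) \<in> rad q" .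
    obtain r where r: "r \<in> cyc" "ev F (cnj y) * r = prim_norm p F"
      using prim_norm_factor[OF p0 prim_cnj[OF y]] by blast
    obtain a where a: "ev F (cnj y) * r = of_int a" "coprime a (int q)"
      using pm_int_coprime[of "prim_norm p F" "int p" "int q"] r(2) 2 cop by auto
    have "y ^ b + y ^ c \<in> rad q"
      by (rule rad_cancel[OF * a(1) _ _ a(2)]) (use yc r in auto)
    then show False using sum_root_unity_not_in_rad[OF q p(2) prim_power_self[OF y]] by blast
  qed
  obtain e' b where e': "e' \<in> {1, -1}" "ev F x = e' * x ^ b * ev F (cnj x)"
    using unit_eq_root_times_cnj[OF q(2) _ x] 3 unfolding prim_norm_def by blast
  \<comment> \<open>\<open>F(1)\<close> is \<open>p\<close> or \<open>-p\<close>, hence prime to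
    \<open>q\<close>, which makes the sign at \<open>x\<close> positive.\<close>
  have "\<not> int q dvd poly F 1"
  proof
    assume *: "int q dvd poly F 1"
    have "of_int (poly F 1) = (of_int (int p) :: complex) \<or> of_int (poly F 1)
        = (of_int (- int p) :: complex)"
      using 1 by simp
    then have "poly F 1 = int p \<or> poly F 1 = - int p" by (simp only: of_int_eq_iff)
    then have "int q dvd int p" using * by auto
    then have "q dvd p" by simp
    then show False using primes_dvd_imp_eq[OF q(1) p(1)] pq by simp
  qed
  then have "e' = 1" using sign_pos_at_prime[OF q x e'] by blast
  have *: "(x ^ b + x ^ c) * ev F (cnj x) \<in> rad p"
    using modp unfolding e'(2) \<open>e' = 1\<close> \<open>e = -1\<close> by (simp add: algebra_simps)
  obtain r where r: "r \<in> cyc" "ev F (cnj x) * r = prim_norm q F"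
    using prim_norm_factor[OF q0 prim_cnj[OF x]] by blast
  obtain a where a: "ev F (cnj x) * r = of_int a" "coprime a (int p)"
    using pm_int_coprime[of "prim_norm q F" 1 "int p"] r(2) 3 by auto
  have "x ^ b + x ^ c \<in> rad p"
    by (rule rad_cancel[OF * a(1) _ _ a(2)]) (use xc r in auto)
  then show False using sum_root_unity_not_in_rad[OF p q(2) prim_power_self[OF x]] by blast
qed

section \<open>Distribution of the factors p among the norms\<close>

lemma prod_int_eq_1_imp:
  fixes f :: "'a \<Rightarrow> int"
  assumes "finite A" "prod f A = 1" "x \<in> A"
  shows "f x \<in> {1, -1}"
  using dvd_prodI[OF assms(1,3), of f] assms(2) by (auto simp: zdvd1_eq abs_if split: if_splits)

lemma divisor_of_prime_power_times_prime:
  fixes p q d :: nat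
  assumes "prime p" "prime q" "d dvd p ^ \<alpha> * q"
  obtains i m where "i \<le> \<alpha>" "m \<in> {1, q}" "d = p ^ i * m"
proof -
  obtain b c where bc: "d = b * c" "b dvd p ^ \<alpha>" "c dvd q"
      using division_decomp[OF assms(3)] by blast
  obtain i where "i \<le> \<alpha>" "b = p ^ i" using bc(2) divides_primepow_nat[OF assms(1)] by blast
  moreover have "c \<in> {1, q}" using bc(3) assms(2) by (auto simp: prime_nat_iff)
  ultimately show ?thesis using that bc(1) by blast
qed

text \<open>Divisibility by \<open>p\<close> at one divisor spreads to all
  \<open>\<alpha> + 1\<close> divisors \<open>p ^ i * m\<close> with the same \<open>m\<close>; one
  factor \<open>p\<close> for each already exhausts the product.\<close>

lemma prim_norm_values:
  assumes p: "prime p" "odd p" and q: "prime q" and pq: "p \<noteq> q"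
    and M: "(\<Prod>z\<in>{z. z ^ (p ^ \<alpha> * q) = 1}. ev F z) = of_nat (p ^ (\<alpha> + 1))"
  obtains m where "m \<in> {1, q}" "\<And>i. i \<le> \<alpha> \<Longrightarrow> prim_norm (p ^ i * m) F \<in> {of_nat p, - of_nat p}"
    "\<And>i m'. i \<le> \<alpha> \<Longrightarrow> m' \<in> {1, q} \<Longrightarrow> m' \<noteq> m \<Longrightarrow> prim_norm (p ^ i * m') F \<in> {1, -1}"
proof -
  define n where "n = p ^ \<alpha> * q"
  have p1: "p > 1" and q1: "q > 1" using p q prime_gt_1_nat by auto
  have cop: "coprime p q" using p q pq by (simp add: primes_coprime)
  have n0: "n > 0" using p1 q1 by (simp add: n_def)
  define D where "D = {d. d dvd n}"
  have fD: "finite D" using n0 by (simp add: D_def)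
  have "\<forall>d\<in>D. \<exists>a. prim_norm d F = of_int a"
    using prim_norm_is_int[OF n0, of F] M p1 unfolding D_def n_def by (auto elim!: Ints_cases)
  then obtain A where A: "\<And>d. d \<in> D \<Longrightarrow> prim_norm d F = of_int (A d)" by metis
  have "complex_of_int (\<Prod>d\<in>D. A d) = of_int (int p ^ (\<alpha> + 1))"
    using M A prod_roots_eq_prod_prim_norm[OF n0, of F] by (simp add: n_def D_def)
  then have AD: "(\<Prod>d\<in>D. A d) = int p ^ (\<alpha> + 1)" by (simp only: of_int_eq_iff)
  then have "int p dvd (\<Prod>d\<in>D. A d)" by simp
  then obtain d0 where d0: "d0 \<in> D" "int p dvd A d0"
    using p(1) fD by (auto simp: prime_dvd_prod_iff)
  obtain j m where jm: "j \<le> \<alpha>" "m \<in> {1, q}" "d0 = p ^ j * m"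
    using divisor_of_prime_power_times_prime[OF p(1) q, of d0 \<alpha>] d0(1) by (auto simp: D_def n_def)
  have inD: "p ^ i * m' \<in> D" if "i \<le> \<alpha>" "m' \<in> {1, q}" for i m'
    using that by (auto simp: D_def n_def le_imp_power_dvd intro: mult_dvd_mono dvd_mult2)
  have m: "m > 0" "coprime p m" "m \<in> D" using jm(2) q1 cop inD[of 0 m] by auto
  have pdvd: "int p dvd A (p ^ i * m)" if "i \<le> \<alpha>" for i
    using prim_norm_dvd_iff[OF p m(1,2) A[OF inD[OF that jm(2)]] A[OF m(3)]]
      prim_norm_dvd_iff[OF p m(1,2) A[OF inD[OF jm(1,2)]] A[OF m(3)]] d0(2) jm(3) by simp
  define S where "S = (\<lambda>i. p ^ i * m) ` {..\<alpha>}"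
  have SD: "S \<subseteq> D" using inD jm(2) by (auto simp: S_def)
  have "inj_on (\<lambda>i. p ^ i * m) {..\<alpha>}" using p1 m(1) by (auto simp: inj_on_def power_inject_exp)
  then have cS: "card S = \<alpha> + 1" by (simp add: S_def card_image)
  \<comment> \<open>One factor \<open>p\<close> is removed from each norm indexed by
    \<open>S\<close>; the integers \<open>c d\<close> have product 1, so each is a unit.\<close>
  define c where "c d = (if d \<in> S then A d div int p else A d)" for d
  have Ac: "A d = int p * c d" if "d \<in> S" for d using that pdvd by (auto simp: c_def S_def)
  have "(\<Prod>d\<in>D. A d) = (\<Prod>d\<in>D - S. A d) * (\<Prod>d\<in>S. A d)"
    using prod.subset_diff[OF SD fD] .
  also have "(\<Prod>d\<in>S. A d) = int p ^ (\<alpha> + 1) * (\<Prod>d\<in>S. c d)"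
    by (simp add: Ac prod.distrib cS cong: prod.cong)
  also have "(\<Prod>d\<in>D - S. A d) = (\<Prod>d\<in>D - S. c d)"
    by (intro prod.cong) (auto simp: c_def)
  also have "(\<Prod>d\<in>D - S. c d) * (int p ^ (\<alpha> + 1) * (\<Prod>d\<in>S. c d)) = int p ^ (\<alpha> + 1) * (\<Prod>d\<in>D. c d)"
    using prod.subset_diff[OF SD fD, of c] by simp
  finally have "int p ^ (\<alpha> + 1) * (\<Prod>d\<in>D. c d) = int p ^ (\<alpha> + 1) * 1" using AD by simp
  then have "(\<Prod>d\<in>D. c d) = 1" using p1 by (subst (asm) mult_left_cancel) auto
  then have c1: "c d \<in> {1, -1}" if "d \<in> D" for d using prod_int_eq_1_imp[OF fD _ that] by blast
  show ?thesis
  proof (rule that[OF jm(2)])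
    fix i assume i: "i \<le> \<alpha>"
    then have S: "p ^ i * m \<in> S" by (auto simp: S_def)
    then have "c (p ^ i * m) \<in> {1, -1}" using c1 SD by blast
    then have "A (p ^ i * m) \<in> {int p, - int p}" using Ac[OF S] by auto
    then show "prim_norm (p ^ i * m) F \<in> {of_nat p, - of_nat p}"
        using A[of "p ^ i * m"] S SD by auto
  next
    fix i m' assume i: "i \<le> \<alpha>" and m': "m' \<in> {1, q}" "m' \<noteq> m"
    have "p ^ i * m' \<notin> S"
    proof
      assume "p ^ i * m' \<in> S"
      then obtain k where k: "p ^ i * m' = p ^ k * m" by (auto simp: S_def)
      \<comment> \<open>As \<open>m\<close> and \<open>m'\<close> are 1 and \<open>q\<close> in some
        order, the equality \<open>k\<close> would make \<open>q\<close> divide a power of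
        \<open>p\<close>.\<close>
      have "\<not> q dvd p ^ l" for l
        using p q pq prime_dvd_power primes_dvd_imp_eq by blast
      then show False using k m' jm(2)
          by (metis dvd_triv_right insertE mult.right_neutral singletonD)
    qed
    then have "A (p ^ i * m') \<in> {1, -1}" using c1[OF inD[OF i m'(1)]] by (simp add: c_def)
    then show "prim_norm (p ^ i * m') F \<in> {1, -1}" using A[OF inD[OF i m'(1)]] by auto
  qed
qed

theorem theorem1:
  fixes n p q \<alpha> :: nat
  assumes "n > 0"
    and "prime p" and "odd p" and "p dvd n"
    and "prime q" and "odd q" and "q dvd n"
    and "p \<noteq> q"
    and "\<alpha> \<ge> 1" and "p ^ \<alpha> dvd n" and "\<not> p ^ (\<alpha> + 1) dvd n"
  shows "int (p ^ (\<alpha> + 1)) \<notin> circulant_dets n"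
proof
  assume "int (p ^ (\<alpha> + 1)) \<in> circulant_dets n"
  then obtain a where a: "a \<in> carrier_vec n" "int (p ^ (\<alpha> + 1)) = det (circulant_mat a)"
    by (auto simp: circulant_dets_def)
  obtain F where "of_int (det (circulant_mat a)) = (\<Prod>v\<in>{v. v ^ n = 1}. ev F v)"
    using det_circulant_mat[OF a(1) assms(1)] by blast
  then have F: "(\<Prod>v\<in>{v. v ^ n = 1}. ev F v) = of_nat (p ^ (\<alpha> + 1))"
    using a(2) by (metis of_int_of_nat_eq)
  have cop: "coprime p q" using assms by (simp add: primes_coprime)
  define n' where "n' = p ^ \<alpha> * q"
  have "n' dvd n" using assms cop by (simp add: n'_def divides_mult)
  then obtain k where k: "n = k * n'" by (metis dvdE mult.commute)
  have k0: "k > 0" and n'0: "n' > 0" using k assms(1) by (auto intro!: Nat.gr0I)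
  obtain H where H: "\<And>w. w \<noteq> 0 \<Longrightarrow> ev H w = (\<Prod>v\<in>{v. v ^ k = w}. ev F v)"
    using norm_poly_exists[OF k0] by blast
  \<comment> \<open>Grouping the \<open>n\<close>-th roots of unity by their \<open>k\<close>-th
    powers shows that \<open>H\<close> has the same total product over the \<open>n'\<close>-th
    roots as \<open>F\<close> over the \<open>n\<close>-th.\<close>
  have "(\<Prod>w\<in>{w. w ^ n' = 1}. ev H w)
      = (\<Prod>w\<in>{w. w ^ n' = 1}. \<Prod>v\<in>{v \<in> {v. v ^ n = 1}. v ^ k = w}. ev F v)"
  proof (intro prod.cong refl)
    fix w :: complex assume w: "w \<in> {w. w ^ n' = 1}"
    then have "w \<noteq> 0" using n'0 by (auto simp: power_0_left)
    moreover have "{v. v ^ k = w} = {v \<in> {v. v ^ n = 1}. v ^ k = w}"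
        using w by (auto simp: k power_mult)
    ultimately show "ev H w = (\<Prod>v\<in>{v \<in> {v. v ^ n = 1}. v ^ k = w}. ev F v)" using H by simp
  qed
  also have "\<dots> = (\<Prod>v\<in>{v. v ^ n = 1}. ev F v)"
  proof (rule prod.group)
    show "(\<lambda>v. v ^ k) ` {v::complex. v ^ n = 1} \<subseteq> {w. w ^ n' = 1}" by (auto simp: k power_mult)
  qed (use assms(1) n'0 in simp_all)
  finally have M: "(\<Prod>w\<in>{w. w ^ (p ^ \<alpha> * q) = 1}. ev H w) = of_nat (p ^ (\<alpha> + 1))"
    unfolding F n'_def .
  obtain m where m: "m \<in> {1, q}" "\<And>i. i \<le> \<alpha> \<Longrightarrow> prim_norm (p ^ i * m) H \<in> {of_nat p, - of_nat p}"
    "\<And>i m'. i \<le> \<alpha> \<Longrightarrow> m' \<in> {1, q} \<Longrightarrow> m' \<noteq> m \<Longrightarrow> prim_norm (p ^ i * m') H \<in> {1, -1}"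
    using prim_norm_values[OF assms(2,3,5,8) M] by blast
  have q1: "q \<noteq> 1" using assms(5) by auto
  show False
  proof (cases "m = 1")
    case True
    \<comment> \<open>The norms at 1 and \<open>p\<close> are \<open>p\<close> up to sign, those at
      \<open>q\<close> and \<open>p * q\<close> are units; the index \<open>i = 1\<close> is
      available since \<open>\<alpha> \<ge> 1\<close>.\<close>
    show ?thesis
      by (rule not_norm_p_at_p_unit_at_pq[OF assms(2,3,5,6,8), of H])
        (use True q1 m(2)[of 0] m(2)[of 1] m(3)[of 0 q] m(3)[of 1 q] assms(9) in auto)
  next
    case False
    then have "m = q" using m(1) by simp
    \<comment> \<open>Here the norm at \<open>p\<close> is a unit and the one at
      \<open>p * q\<close> is \<open>p\<close> up to sign.\<close>
    show ?thesis
      by (rule not_unit_at_p_norm_p_at_pq[OF assms(2,3,5,6,8), of H])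
        (use \<open>m = q\<close> q1 m(2)[of 1] m(3)[of 1 1] assms(9) in auto)
  qed
qed

end
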